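(* Let $\{M_j\}$ be a sequence of (precompact) open Riemannian manifolds such that $(\bar M_j,d_{M_j})$ converges in the Gromov-Hausdorff sense to a compact metric space $(X,d_X)$. Suppose $Y$ is a glued limit space of $\{M_j\}$. Then the completed glued limit $\bar Y$ is isometric to the closure $\bar U_{\{j_k\}}\subset X$ of any limit's inner union $U_{\{j_k\}}\subset X$, for any subsequence $\{j_k\}$. In particular, any completed glued limit and the closure of any of the limit's inner unions are isometric.
   Context: For an open (not necessarily complete) Riemannian manifold $(M,g)$, $d_M$ is the length metric, $\bar M$ the metric completion, $\partial M:=\bar M\setminus M$ (no regularity assumed), $M^\delta=\{x\in M:d_M(x,\partial M)>\delta\}$ ($M^\delta=M$ if $\partial M=\emptyset$), and $\bar M^\delta$ is the metric completion of $M^\delta$ with the restricted metric $d_M$. Isometric embeddings are distance-preserving maps. The Gromov-Hausdorff (or Hausdorff) limit of empty spaces is the empty space. Glued limit spaces. Let $\delta_0\ge\delta_1\ge\cdots$ be positive numbers decreasing to $0$ such that for every $i$, $(\bar M_j^{\delta_i},d_{M_j})$ converges as $j\to\infty$ (without passing to a subsequence) in the Gromov-Hausdorff sense to a compact metric space $Y^{\delta_i}$ (possibly empty). A subsequential limit isometric embedding $\varphi_{\delta_{i+1},\delta_i}:Y^{\delta_i}\to Y^{\delta_{i+1}}$ is one arising as follows: there are a compact metric space $Z_i$, isometric embeddings $\varphi_j:\bar M_j^{\delta_{i+1}}\to Z_i$, $\varphi_\infty:Y^{\delta_{i+1}}\to Z_i$ with $\varphi_j(\bar M_j^{\delta_{i+1}})\to\varphi_\infty(Y^{\delta_{i+1}})$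 in the Hausdorff sense, and a subsequence with $\varphi_{j_k}(\bar M_{j_k}^{\delta_i})\to\varphi_\infty(\varphi_{\delta_{i+1},\delta_i}(Y^{\delta_i}))$ in the Hausdorff sense; it is the identity if $\delta_{i+1}=\delta_i$. Given such a map for each $i$, let $\varphi_{\delta_a,\delta_b}:Y^{\delta_b}\to Y^{\delta_a}$ ($a\ge b$) be the compositions ($\varphi_{\delta_a,\delta_a}=\mathrm{id}$), and let $Y=Y^{\delta_0}\sqcup\bigsqcup_{i=0}^\infty(Y^{\delta_{i+1}}\setminus\varphi_{\delta_{i+1},\delta_i}(Y^{\delta_i}))$. If $x\in Y$ lies in the piece contained in $Y^{\delta_a}$ and $y\in Y$ in the piece contained in $Y^{\delta_b}$ with $a\ge b$, then $d_Y(x,y)=d_Y(y,x)=d_{Y^{\delta_a}}(x,\varphi_{\delta_a,\delta_b}(y))$. Any such $(Y,d_Y)$ is a glued limit space of $\{M_j\}$; its metric completion $\bar Y$ is a completed glued limit. Limit's inner unions. Since $\bar M_j\to X$, there are a compact metric space $Z$ and isometric embeddings $\varphi_j:\bar M_j\to Z$, $\varphi:X\to Z$ with $\varphi_j(\bar M_j)\to\varphi(X)$ in the Hausdorff sense. For a subsequence $\{j_k\}$ let $D_{\{j_k\}}$ be the set of $\delta>0$ for which $\varphi_{j_k}(\bar M_{j_k}^\delta)$ converges in the Hausdorff sense to a compact set $W^\delta(j_k)\subset\varphi(X)$, and put $Y^\delta(j_k)=\varphi^{-1}(W^\delta(j_k))\subset X$. One considers subsequences $\{j_k\}$ for which $D_{\{j_k\}}$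 contains a sequence converging to $0$ (these always exist). The limit's inner union is $U_{\{j_k\}}=\bigcup_{\delta\in D_{\{j_k\}}}Y^\delta(j_k)\subset X$, with the metric restricted from $X$. *)

theory Defs
  imports "HOL-Analysis.Analysis"
begin

section \<open>Riemannian manifolds\<close>

text \<open>
  The dimension is a natural number stored in the manifold (so it may vary along a sequence of
  manifolds); charts take values in the library's \<open>Euclidean_space n\<close>, whose points are the
  functions of type \<open>nat \<Rightarrow> real\<close> vanishing at all indices \<open>\<ge> n\<close>.
\<close>

definition partial_deriv :: "nat \<Rightarrow> ((nat \<Rightarrow> real) \<Rightarrow> real) \<Rightarrow> (nat \<Rightarrow> real) \<Rightarrow> real" where
  "partial_deriv i f x = deriv (\<lambda>t. f (x(i := t))) (x i)"

primrec Ck_on :: "nat \<Rightarrow> nat \<Rightarrow> (nat \<Rightarrow> real) set \<Rightarrow> ((nat \<Rightarrow> real) \<Rightarrow> real) \<Rightarrow> bool" where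
  "Ck_on n 0 U f \<longleftrightarrow> continuous_map (subtopology (Euclidean_space n) U) euclideanreal f"
| "Ck_on n (Suc k) U f \<longleftrightarrow>
     continuous_map (subtopology (Euclidean_space n) U) euclideanreal f \<and>
     (\<forall>i<n. (\<forall>x\<in>U. (\<lambda>t. f (x(i := t))) differentiable (at (x i))) \<and>
            Ck_on n k U (partial_deriv i f))"

definition smooth_on :: "nat \<Rightarrow> (nat \<Rightarrow> real) set \<Rightarrow> ((nat \<Rightarrow> real) \<Rightarrow> real) \<Rightarrow> bool" where
  "smooth_on n U f \<longleftrightarrow> (\<forall>k. Ck_on n k U f)"

type_synonym 'a chart = "'a set \<times> ('a \<Rightarrow> nat \<Rightarrow> real)"

text \<open>
  \<open>gcoef M c x i j\<close> is the coefficient \<open>g\<^sub>i\<^sub>j\<close> of the Riemannian metric in the chart \<open>c\<close>, as a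
  function of the coordinates \<open>x\<close>.
\<close>

record 'a riem =
  mantop :: "'a topology"
  mandim :: nat
  atlas :: "'a chart set"
  gcoef :: "'a chart \<Rightarrow> (nat \<Rightarrow> real) \<Rightarrow> nat \<Rightarrow> nat \<Rightarrow> real"

abbreviation points :: "'a riem \<Rightarrow> 'a set" where
  "points M \<equiv> topspace (mantop M)"

definition transition :: "'a chart \<Rightarrow> 'a chart \<Rightarrow> nat \<Rightarrow> (nat \<Rightarrow> real) \<Rightarrow> real" where
  "transition c c' k x = snd c' (inv_into (fst c) (snd c) x) k"

definition smooth_manifold :: "'a riem \<Rightarrow> bool" where
  "smooth_manifold M \<longleftrightarrow>
     Hausdorff_space (mantop M) \<and> second_countable (mantop M) \<and>
     (\<Union>c\<in>atlas M. fst c) = points M \<and>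
     (\<forall>c\<in>atlas M.
        openin (mantop M) (fst c) \<and>
        openin (Euclidean_space (mandim M)) (snd c ` fst c) \<and>
        homeomorphic_map (subtopology (mantop M) (fst c))
          (subtopology (Euclidean_space (mandim M)) (snd c ` fst c)) (snd c)) \<and>
     (\<forall>c\<in>atlas M. \<forall>c'\<in>atlas M. \<forall>k<mandim M.
        smooth_on (mandim M) (snd c ` (fst c \<inter> fst c')) (transition c c' k))"

definition riemannian_metric :: "'a riem \<Rightarrow> bool" where
  "riemannian_metric M \<longleftrightarrow>
     (\<forall>c\<in>atlas M. \<forall>i<mandim M. \<forall>j<mandim M.
        smooth_on (mandim M) (snd c ` fst c) (\<lambda>x. gcoef M c x i j)) \<and>
     (\<forall>c\<in>atlas M. \<forall>x\<in>snd c ` fst c. \<forall>i<mandim M. \<forall>j<mandim M.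
        gcoef M c x i j = gcoef M c x j i) \<and>
     (\<forall>c\<in>atlas M. \<forall>x\<in>snd c ` fst c. \<forall>v :: nat \<Rightarrow> real. (\<exists>i<mandim M. v i \<noteq> 0) \<longrightarrow>
        (\<Sum>i<mandim M. \<Sum>j<mandim M. gcoef M c x i j * v i * v j) > 0) \<and>
     (\<forall>c\<in>atlas M. \<forall>c'\<in>atlas M. \<forall>p\<in>fst c \<inter> fst c'. \<forall>i<mandim M. \<forall>j<mandim M.
        gcoef M c (snd c p) i j =
          (\<Sum>k<mandim M. \<Sum>l<mandim M. gcoef M c' (snd c' p) k l *
             partial_deriv i (transition c c' k) (snd c p) *
             partial_deriv j (transition c c' l) (snd c p)))"

text \<open>
  No completeness is required. Connectedness makes the length metric finite.
\<close>

definition open_riemannian_manifold :: "'a riem \<Rightarrow> bool" where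
  "open_riemannian_manifold M \<longleftrightarrow>
     smooth_manifold M \<and> riemannian_metric M \<and> connected_space (mantop M)"

definition C1_in_chart :: "'a riem \<Rightarrow> 'a chart \<Rightarrow> real set \<Rightarrow> (real \<Rightarrow> 'a) \<Rightarrow> bool" where
  "C1_in_chart M c I \<gamma> \<longleftrightarrow> \<gamma> ` I \<subseteq> fst c \<and>
     (\<forall>i<mandim M. \<exists>v. continuous_on I v \<and>
        (\<forall>t\<in>I. ((\<lambda>s. snd c (\<gamma> s) i) has_real_derivative v t) (at t within I)))"

definition speed_in_chart :: "'a riem \<Rightarrow> 'a chart \<Rightarrow> real set \<Rightarrow> (real \<Rightarrow> 'a) \<Rightarrow> real \<Rightarrow> real" where
  "speed_in_chart M c I \<gamma> t =
     sqrt (\<Sum>i<mandim M. \<Sum>j<mandim M. gcoef M c (snd c (\<gamma> t)) i j *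
             vector_derivative (\<lambda>s. snd c (\<gamma> s) i) (at t within I) *
             vector_derivative (\<lambda>s. snd c (\<gamma> s) j) (at t within I))"

text \<open>
  \<open>has_riem_length M \<gamma> a b L\<close>: \<open>\<gamma>\<close> restricted to \<open>[a, b]\<close> is a piecewise \<open>C\<^sup>1\<close> curve of length \<open>L\<close>.
  By compactness, every piecewise \<open>C\<^sup>1\<close> curve has a subdivision whose closed pieces are \<open>C\<^sup>1\<close> and lie in
  single charts; by the transformation law for \<open>gcoef\<close>, its length does not depend on the subdivision
  or on the charts. A curve with \<open>a = b\<close> (empty sum, \<open>m = 0\<close>) has length \<open>0\<close>.
\<close>

definition has_riem_length :: "'a riem \<Rightarrow> (real \<Rightarrow> 'a) \<Rightarrow> real \<Rightarrow> real \<Rightarrow> real \<Rightarrow> bool" where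
  "has_riem_length M \<gamma> a b L \<longleftrightarrow>
     (\<exists>m t c. t 0 = a \<and> t m = b \<and>
        (\<forall>i<m. t i < t (Suc i) \<and> c i \<in> atlas M \<and> C1_in_chart M (c i) {t i..t (Suc i)} \<gamma>) \<and>
        L = (\<Sum>i<m. integral {t i..t (Suc i)} (speed_in_chart M (c i) {t i..t (Suc i)} \<gamma>)))"

definition riem_dist :: "'a riem \<Rightarrow> 'a \<Rightarrow> 'a \<Rightarrow> real" where
  "riem_dist M x y = Inf {L. \<exists>\<gamma> a b. \<gamma> a = x \<and> \<gamma> b = y \<and> has_riem_length M \<gamma> a b L}"


section \<open>Metric completion\<close>

definition cauchy_seqs :: "'a set \<Rightarrow> ('a \<Rightarrow> 'a \<Rightarrow> real) \<Rightarrow> (nat \<Rightarrow> 'a) set" where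
  "cauchy_seqs S d =
     {x. range x \<subseteq> S \<and> (\<forall>e>0. \<exists>N. \<forall>m\<ge>N. \<forall>n\<ge>N. d (x m) (x n) < e)}"

definition cauchy_class :: "'a set \<Rightarrow> ('a \<Rightarrow> 'a \<Rightarrow> real) \<Rightarrow> (nat \<Rightarrow> 'a) \<Rightarrow> (nat \<Rightarrow> 'a) set" where
  "cauchy_class S d x = {y \<in> cauchy_seqs S d. (\<lambda>n. d (x n) (y n)) \<longlonglongrightarrow> 0}"

definition completion_points :: "'a set \<Rightarrow> ('a \<Rightarrow> 'a \<Rightarrow> real) \<Rightarrow> (nat \<Rightarrow> 'a) set set" where
  "completion_points S d = cauchy_class S d ` cauchy_seqs S d"

text \<open>
  The value \<open>0\<close> outside the completion serves the locale \<open>Metric_space\<close>, which asks for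
  nonnegativity and symmetry on the whole type.
\<close>

definition completion_dist ::
    "'a set \<Rightarrow> ('a \<Rightarrow> 'a \<Rightarrow> real) \<Rightarrow> (nat \<Rightarrow> 'a) set \<Rightarrow> (nat \<Rightarrow> 'a) set \<Rightarrow> real" where
  "completion_dist S d p q =
     (if p \<in> completion_points S d \<and> q \<in> completion_points S d
      then THE l. \<exists>x\<in>p. \<exists>y\<in>q. (\<lambda>n. d (x n) (y n)) \<longlonglongrightarrow> l
      else 0)"

definition completion :: "'a set \<Rightarrow> ('a \<Rightarrow> 'a \<Rightarrow> real) \<Rightarrow> (nat \<Rightarrow> 'a) set metric" where
  "completion S d = metric (completion_points S d, completion_dist S d)"

text \<open>The canonical maps \<open>S \<rightarrow> completion S d\<close> and, for \<open>T \<subseteq> S\<close>, \<open>completion T d \<rightarrow> completion S d\<close>.\<close>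

definition completion_embed :: "'a set \<Rightarrow> ('a \<Rightarrow> 'a \<Rightarrow> real) \<Rightarrow> 'a \<Rightarrow> (nat \<Rightarrow> 'a) set" where
  "completion_embed S d x = cauchy_class S d (\<lambda>_. x)"

definition completion_incl ::
    "'a set \<Rightarrow> ('a \<Rightarrow> 'a \<Rightarrow> real) \<Rightarrow> (nat \<Rightarrow> 'a) set \<Rightarrow> (nat \<Rightarrow> 'a) set" where
  "completion_incl S d p = (\<Union>x\<in>p. cauchy_class S d x)"

locale pseudometric_on =
  fixes S :: "'a set" and d :: "'a \<Rightarrow> 'a \<Rightarrow> real"
  assumes refl: "x \<in> S \<Longrightarrow> d x x = 0"
    and sym: "x \<in> S \<Longrightarrow> y \<in> S \<Longrightarrow> d x y = d y x"
    and tri: "x \<in> S \<Longrightarrow> y \<in> S \<Longrightarrow> z \<in> S \<Longrightarrow> d x z \<le> d x y + d y z"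
begin

lemma nonneg: "x \<in> S \<Longrightarrow> y \<in> S \<Longrightarrow> 0 \<le> d x y"
  using tri[of x y x] refl[of x] sym[of x y] by simp

lemma quad: "\<lbrakk>x \<in> S; y \<in> S; x' \<in> S; y' \<in> S\<rbrakk> \<Longrightarrow> \<bar>d x y - d x' y'\<bar> \<le> d x x' + d y y'"
  using tri[of x x' y] tri[of x' y' y] tri[of x' x y'] tri[of x y y'] sym[of x x'] sym[of y y']
  by auto

lemma cauchy_in: "x \<in> cauchy_seqs S d \<Longrightarrow> x n \<in> S"
  by (auto simp: cauchy_seqs_def)

lemma dist_convergent:
  assumes "x \<in> cauchy_seqs S d" "y \<in> cauchy_seqs S d"
  shows "\<exists>l. (\<lambda>n. d (x n) (y n)) \<longlonglongrightarrow> l"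
proof -
  have "Cauchy (\<lambda>n. d (x n) (y n))"
  proof (rule metric_CauchyI)
    fix e :: real assume "e > 0"
    then have "e / 2 > 0" by simp
    moreover have "\<forall>e>0. \<exists>N. \<forall>m\<ge>N. \<forall>n\<ge>N. d (z m) (z n) < e"
      if "z \<in> cauchy_seqs S d" for z
      using that by (simp add: cauchy_seqs_def)
    ultimately obtain N1 N2 where
      N1: "\<forall>m\<ge>N1. \<forall>n\<ge>N1. d (x m) (x n) < e / 2" and
      N2: "\<forall>m\<ge>N2. \<forall>n\<ge>N2. d (y m) (y n) < e / 2"
      using assms by meson
    have "dist (d (x m) (y m)) (d (x n) (y n)) < e" if "m \<ge> max N1 N2" "n \<ge> max N1 N2" for m n
    proof -
      have "d (x m) (x n) < e / 2" "d (y m) (y n) < e / 2"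
        using N1 N2 that by auto
      then show ?thesis
        using quad[of "x m" "y m" "x n" "y n", OF assms[THEN cauchy_in] assms[THEN cauchy_in]]
        unfolding dist_real_def by linarith
    qed
    then show "\<exists>M. \<forall>m\<ge>M. \<forall>n\<ge>M. dist (d (x m) (y m)) (d (x n) (y n)) < e"
      by blast
  qed
  then show ?thesis
    using Cauchy_convergent_iff convergent_def by blast
qed

lemma lim_cong:
  assumes xy: "x \<in> cauchy_seqs S d" "y \<in> cauchy_seqs S d" "x' \<in> cauchy_class S d x"
    "y' \<in> cauchy_class S d y"
    and l: "(\<lambda>n. d (x n) (y n)) \<longlonglongrightarrow> l"
  shows "(\<lambda>n. d (x' n) (y' n)) \<longlonglongrightarrow> l"
proof -
  have x': "x' \<in> cauchy_seqs S d" "(\<lambda>n. d (x n) (x' n)) \<longlonglongrightarrow> 0"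
    and y': "y' \<in> cauchy_seqs S d" "(\<lambda>n. d (y n) (y' n)) \<longlonglongrightarrow> 0"
    using xy by (auto simp: cauchy_class_def)
  have "(\<lambda>n. d (x n) (x' n) + d (y n) (y' n)) \<longlonglongrightarrow> 0"
    using tendsto_add[OF x'(2) y'(2)] by simp
  then have "(\<lambda>n. d (x n) (y n) - d (x' n) (y' n)) \<longlonglongrightarrow> 0"
    by (rule Lim_null_comparison[rotated])
       (auto intro!: always_eventually quad cauchy_in xy x' y')
  then show ?thesis
    using tendsto_diff[OF l] by fastforce
qed

lemma self_in_class: "x \<in> cauchy_seqs S d \<Longrightarrow> x \<in> cauchy_class S d x"
  by (auto simp: cauchy_class_def refl cauchy_in)

lemma completion_dist_eq:
  assumes "x \<in> cauchy_seqs S d" "y \<in> cauchy_seqs S d" "(\<lambda>n. d (x n) (y n)) \<longlonglongrightarrow> l"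
  shows "completion_dist S d (cauchy_class S d x) (cauchy_class S d y) = l"
proof -
  have "(THE l. \<exists>u\<in>cauchy_class S d x. \<exists>v\<in>cauchy_class S d y. (\<lambda>n. d (u n) (v n)) \<longlonglongrightarrow> l) = l"
  proof (rule the_equality)
    show "\<exists>u\<in>cauchy_class S d x. \<exists>v\<in>cauchy_class S d y. (\<lambda>n. d (u n) (v n)) \<longlonglongrightarrow> l"
      using assms self_in_class by blast
  next
    fix l' assume "\<exists>u\<in>cauchy_class S d x. \<exists>v\<in>cauchy_class S d y. (\<lambda>n. d (u n) (v n)) \<longlonglongrightarrow> l'"
    then obtain u v where u: "u \<in> cauchy_class S d x" and v: "v \<in> cauchy_class S d y"
      and l': "(\<lambda>n. d (u n) (v n)) \<longlonglongrightarrow> l'" by blast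
    show "l' = l"
      by (rule LIMSEQ_unique[OF l' lim_cong[OF assms(1,2) u v assms(3)]])
  qed
  then show ?thesis
    using assms by (simp add: completion_dist_def completion_points_def)
qed

lemma class_eq:
  assumes "x \<in> cauchy_seqs S d" "y \<in> cauchy_seqs S d"
  shows "cauchy_class S d x = cauchy_class S d y \<longleftrightarrow> (\<lambda>n. d (x n) (y n)) \<longlonglongrightarrow> 0"
proof
  assume "cauchy_class S d x = cauchy_class S d y"
  then show "(\<lambda>n. d (x n) (y n)) \<longlonglongrightarrow> 0"
    using self_in_class[OF assms(2)] by (auto simp: cauchy_class_def)
next
  assume 0: "(\<lambda>n. d (x n) (y n)) \<longlonglongrightarrow> 0"
  have "(\<lambda>n. d (y n) (x n)) = (\<lambda>n. d (x n) (y n))"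
    using sym[OF cauchy_in[OF assms(1)] cauchy_in[OF assms(2)]] by auto
  then have 1: "(\<lambda>n. d (y n) (x n)) \<longlonglongrightarrow> 0"
    using 0 by simp
  show "cauchy_class S d x = cauchy_class S d y"
  proof (intro set_eqI iffI)
    fix z assume z: "z \<in> cauchy_class S d x"
    have "y \<in> cauchy_class S d x" using 0 assms by (simp add: cauchy_class_def)
    then have "(\<lambda>n. d (y n) (z n)) \<longlonglongrightarrow> 0"
      using lim_cong[OF assms(1) assms(1) _ z] assms(1) by (simp add: refl cauchy_in)
    then show "z \<in> cauchy_class S d y" using z by (simp add: cauchy_class_def)
  next
    fix z assume z: "z \<in> cauchy_class S d y"
    have "x \<in> cauchy_class S d y" using 1 assms by (simp add: cauchy_class_def)
    then have "(\<lambda>n. d (x n) (z n)) \<longlonglongrightarrow> 0"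
      using lim_cong[OF assms(2) assms(2) _ z] assms(2) by (simp add: refl cauchy_in)
    then show "z \<in> cauchy_class S d x" using z by (simp add: cauchy_class_def)
  qed
qed

lemma Metric_space_completion: "Metric_space (completion_points S d) (completion_dist S d)"
proof
  have rep: thesis
    if pq: "p \<in> completion_points S d" "q \<in> completion_points S d"
      and P: "\<And>x y. \<lbrakk>x \<in> cauchy_seqs S d; y \<in> cauchy_seqs S d; p = cauchy_class S d x;
        q = cauchy_class S d y; (\<lambda>n. d (x n) (y n)) \<longlonglongrightarrow> completion_dist S d p q\<rbrakk> \<Longrightarrow> thesis"
    for p q thesis
  proof -
    obtain x y where xy: "x \<in> cauchy_seqs S d" "y \<in> cauchy_seqs S d"
      "p = cauchy_class S d x" "q = cauchy_class S d y"
      using pq by (auto simp: completion_points_def)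
    obtain l where l: "(\<lambda>n. d (x n) (y n)) \<longlonglongrightarrow> l"
      using dist_convergent[OF xy(1,2)] by blast
    show thesis
      using P[OF xy] l completion_dist_eq[OF xy(1,2) l] xy(3,4) by simp
  qed
  fix p q r
  show "0 \<le> completion_dist S d p q"
  proof (cases "p \<in> completion_points S d \<and> q \<in> completion_points S d")
    case True
    then obtain x y where "x \<in> cauchy_seqs S d" "y \<in> cauchy_seqs S d"
      "(\<lambda>n. d (x n) (y n)) \<longlonglongrightarrow> completion_dist S d p q" using rep by blast
    then show ?thesis
      by (intro LIMSEQ_le_const) (auto intro!: nonneg cauchy_in)
  qed (auto simp: completion_dist_def)
  show "completion_dist S d p q = completion_dist S d q p"
  proof (cases "p \<in> completion_points S d \<and> q \<in> completion_points S d")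
    case True
    then obtain x y where *: "x \<in> cauchy_seqs S d" "y \<in> cauchy_seqs S d"
      "p = cauchy_class S d x" "q = cauchy_class S d y"
      "(\<lambda>n. d (x n) (y n)) \<longlonglongrightarrow> completion_dist S d p q" using rep by blast
    have "(\<lambda>n. d (y n) (x n)) = (\<lambda>n. d (x n) (y n))"
      using sym[OF cauchy_in[OF *(1)] cauchy_in[OF *(2)]] by auto
    then have "(\<lambda>n. d (y n) (x n)) \<longlonglongrightarrow> completion_dist S d p q"
      using *(5) by simp
    then show ?thesis using completion_dist_eq[OF *(2,1)] *(3,4) by simp
  qed (auto simp: completion_dist_def)
  assume p: "p \<in> completion_points S d" and q: "q \<in> completion_points S d"
  show "completion_dist S d p q = 0 \<longleftrightarrow> p = q"
  proof (rule rep[OF p q])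
    fix x y assume *: "x \<in> cauchy_seqs S d" "y \<in> cauchy_seqs S d"
      "p = cauchy_class S d x" "q = cauchy_class S d y"
      "(\<lambda>n. d (x n) (y n)) \<longlonglongrightarrow> completion_dist S d p q"
    show ?thesis
    proof
      assume "completion_dist S d p q = 0"
      then have "(\<lambda>n. d (x n) (y n)) \<longlonglongrightarrow> 0" using *(5) by simp
      then show "p = q" unfolding *(3,4) by (simp add: class_eq[OF *(1,2)])
    next
      assume "p = q"
      then have "(\<lambda>n. d (x n) (y n)) \<longlonglongrightarrow> 0"
        unfolding *(3,4) by (simp add: class_eq[OF *(1,2)])
      then show "completion_dist S d p q = 0" using *(5) LIMSEQ_unique by blast
    qed
  qed
  assume r: "r \<in> completion_points S d"
  obtain x y z where *: "x \<in> cauchy_seqs S d" "y \<in> cauchy_seqs S d" "z \<in> cauchy_seqs S d"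
      "p = cauchy_class S d x" "q = cauchy_class S d y" "r = cauchy_class S d z"
    using p q r by (auto simp: completion_points_def)
  obtain l1 l2 l3 where l: "(\<lambda>n. d (x n) (y n)) \<longlonglongrightarrow> l1" "(\<lambda>n. d (y n) (z n)) \<longlonglongrightarrow> l2"
      "(\<lambda>n. d (x n) (z n)) \<longlonglongrightarrow> l3"
    using *(1-3) dist_convergent by meson
  have "l3 \<le> l1 + l2"
    by (rule LIMSEQ_le[OF l(3) tendsto_add[OF l(1,2)]]) (auto intro!: tri cauchy_in *)
  then show "completion_dist S d p r \<le> completion_dist S d p q + completion_dist S d q r"
    using completion_dist_eq[OF *(1,2) l(1)] completion_dist_eq[OF *(2,3) l(2)]
      completion_dist_eq[OF *(1,3) l(3)] *(4-6) by simp
qed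

end


section \<open>Hausdorff and Gromov-Hausdorff convergence\<close>

definition isometric_embedding :: "'a metric \<Rightarrow> 'b metric \<Rightarrow> ('a \<Rightarrow> 'b) \<Rightarrow> bool" where
  "isometric_embedding A B f \<longleftrightarrow> f \<in> mspace A \<rightarrow> mspace B \<and>
     (\<forall>x\<in>mspace A. \<forall>y\<in>mspace A. mdist B (f x) (f y) = mdist A x y)"

definition isometric :: "'a metric \<Rightarrow> 'b metric \<Rightarrow> bool" where
  "isometric A B \<longleftrightarrow> (\<exists>f. isometric_embedding A B f \<and> f ` mspace A = mspace B)"

text \<open>
  In \<^typ>\<open>ennreal\<close> the distance between two empty sets is \<open>0\<close> and that between an empty and a nonempty
  set is \<open>\<infinity>\<close>; so a sequence converges to the empty set iff it is eventually empty.
\<close>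

definition hausdorff_dist :: "('a \<Rightarrow> 'a \<Rightarrow> real) \<Rightarrow> 'a set \<Rightarrow> 'a set \<Rightarrow> ennreal" where
  "hausdorff_dist d A B =
     max (SUP a\<in>A. INF b\<in>B. ennreal (d a b)) (SUP b\<in>B. INF a\<in>A. ennreal (d a b))"

definition hausdorff_conv :: "'z metric \<Rightarrow> (nat \<Rightarrow> 'z set) \<Rightarrow> 'z set \<Rightarrow> bool" where
  "hausdorff_conv Z A B \<longleftrightarrow> (\<lambda>j. hausdorff_dist (mdist Z) (A j) B) \<longlonglongrightarrow> 0"

text \<open>
  Ambient spaces that are quantified existentially are carried by sets of reals (with an arbitrary
  metric, unrelated to the usual one). This is no restriction: a compact metric space has at most the
  cardinality of the continuum, and so has the union of two isometrically embedded compact spaces.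
\<close>

definition gh_dist :: "'a metric \<Rightarrow> 'b metric \<Rightarrow> ennreal" where
  "gh_dist A B = Inf {hausdorff_dist (mdist Z) (f ` mspace A) (g ` mspace B) | (Z :: real metric) f g.
     isometric_embedding A Z f \<and> isometric_embedding B Z g}"

definition gh_conv :: "(nat \<Rightarrow> 'a metric) \<Rightarrow> 'b metric \<Rightarrow> bool" where
  "gh_conv A B \<longleftrightarrow> (\<lambda>j. gh_dist (A j) B) \<longlonglongrightarrow> 0"

abbreviation compact_metric :: "'a metric \<Rightarrow> bool" where
  "compact_metric Z \<equiv> compact_space (mtopology_of Z)"


section \<open>Inner regions\<close>

definition mcompletion :: "'a riem \<Rightarrow> (nat \<Rightarrow> 'a) set metric" where
  "mcompletion M = completion (points M) (riem_dist M)"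

definition mboundary :: "'a riem \<Rightarrow> (nat \<Rightarrow> 'a) set set" where
  "mboundary M = mspace (mcompletion M) - completion_embed (points M) (riem_dist M) ` points M"

definition inner_region :: "'a riem \<Rightarrow> real \<Rightarrow> 'a set" where
  "inner_region M \<delta> =
     (if mboundary M = {} then points M
      else {x \<in> points M.
        (INF p\<in>mboundary M. mdist (mcompletion M) (completion_embed (points M) (riem_dist M) x) p) > \<delta>})"

definition inner_completion :: "'a riem \<Rightarrow> real \<Rightarrow> (nat \<Rightarrow> 'a) set metric" where
  "inner_completion M \<delta> = completion (inner_region M \<delta>) (riem_dist M)"

text \<open>
  The completed \<open>\<delta>\<close>-inner region as a subset of the completion of \<open>M\<close>, and, for \<open>\<delta>' \<le> \<delta>\<close>, as a subset
  of the completed \<open>\<delta>'\<close>-inner region.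
\<close>

definition inner_in_completion :: "'a riem \<Rightarrow> real \<Rightarrow> (nat \<Rightarrow> 'a) set set" where
  "inner_in_completion M \<delta> =
     completion_incl (points M) (riem_dist M) ` mspace (inner_completion M \<delta>)"

definition inner_in_inner :: "'a riem \<Rightarrow> real \<Rightarrow> real \<Rightarrow> (nat \<Rightarrow> 'a) set set" where
  "inner_in_inner M \<delta>' \<delta> =
     completion_incl (inner_region M \<delta>') (riem_dist M) ` mspace (inner_completion M \<delta>)"


section \<open>Glued limit spaces\<close>

text \<open>
  \<open>Y\<close> and \<open>Y'\<close> are the limits of the completed \<open>\<delta>\<close>- and \<open>\<delta>'\<close>-inner regions, \<open>\<delta>' \<le> \<delta>\<close>.
\<close>

definition subseq_limit_embedding ::
    "(nat \<Rightarrow> 'a riem) \<Rightarrow> real \<Rightarrow> real \<Rightarrow> 'y metric \<Rightarrow> 'y metric \<Rightarrow> ('y \<Rightarrow> 'y) \<Rightarrow> bool" where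
  "subseq_limit_embedding M \<delta>' \<delta> Y' Y \<psi> \<longleftrightarrow>
     isometric_embedding Y Y' \<psi> \<and>
     (\<exists>(Z :: real metric) f g.
        compact_metric Z \<and>
        (\<forall>j. isometric_embedding (inner_completion (M j) \<delta>') Z (f j)) \<and>
        isometric_embedding Y' Z g \<and>
        hausdorff_conv Z (\<lambda>j. f j ` mspace (inner_completion (M j) \<delta>')) (g ` mspace Y') \<and>
        (\<exists>r :: nat \<Rightarrow> nat. strict_mono r \<and>
           hausdorff_conv Z (\<lambda>k. f (r k) ` inner_in_inner (M (r k)) \<delta>' \<delta>) (g ` \<psi> ` mspace Y)))"

definition glued_limit_data ::
    "(nat \<Rightarrow> 'a riem) \<Rightarrow> (nat \<Rightarrow> real) \<Rightarrow> (real \<Rightarrow> 'y metric) \<Rightarrow> (nat \<Rightarrow> 'y \<Rightarrow> 'y) \<Rightarrow> bool" where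
  "glued_limit_data M \<delta> Y \<psi> \<longleftrightarrow>
     (\<forall>i. \<delta> i > 0) \<and> decseq \<delta> \<and> \<delta> \<longlonglongrightarrow> 0 \<and>
     (\<forall>i. compact_metric (Y (\<delta> i)) \<and> gh_conv (\<lambda>j. inner_completion (M j) (\<delta> i)) (Y (\<delta> i))) \<and>
     (\<forall>i. if \<delta> (Suc i) = \<delta> i then \<forall>x\<in>mspace (Y (\<delta> i)). \<psi> i x = x
          else subseq_limit_embedding M (\<delta> (Suc i)) (\<delta> i) (Y (\<delta> (Suc i))) (Y (\<delta> i)) (\<psi> i))"

text \<open>\<open>glue_map \<psi> b n\<close> is the composition \<open>\<psi> (b + n - 1) \<circ> \<dots> \<circ> \<psi> b\<close>.\<close>

primrec glue_map :: "(nat \<Rightarrow> 'y \<Rightarrow> 'y) \<Rightarrow> nat \<Rightarrow> nat \<Rightarrow> 'y \<Rightarrow> 'y" where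
  "glue_map \<psi> b 0 = id"
| "glue_map \<psi> b (Suc n) = \<psi> (b + n) \<circ> glue_map \<psi> b n"

text \<open>The index \<open>a\<close> of a point \<open>(a, x)\<close> says that it comes from the piece contained in \<open>Y (\<delta> a)\<close>.\<close>

definition glued_points ::
    "(nat \<Rightarrow> real) \<Rightarrow> (real \<Rightarrow> 'y metric) \<Rightarrow> (nat \<Rightarrow> 'y \<Rightarrow> 'y) \<Rightarrow> (nat \<times> 'y) set" where
  "glued_points \<delta> Y \<psi> =
     {0} \<times> mspace (Y (\<delta> 0)) \<union>
     (\<Union>i. {Suc i} \<times> (mspace (Y (\<delta> (Suc i))) - \<psi> i ` mspace (Y (\<delta> i))))"

definition glued_dist ::
    "(nat \<Rightarrow> real) \<Rightarrow> (real \<Rightarrow> 'y metric) \<Rightarrow> (nat \<Rightarrow> 'y \<Rightarrow> 'y) \<Rightarrow> nat \<times> 'y \<Rightarrow> nat \<times> 'y \<Rightarrow> real" where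
  "glued_dist \<delta> Y \<psi> = (\<lambda>(a, x) (b, y).
     if b \<le> a then mdist (Y (\<delta> a)) x (glue_map \<psi> b (a - b) y)
     else mdist (Y (\<delta> b)) y (glue_map \<psi> a (b - a) x))"

definition completed_glued_limit ::
    "(nat \<Rightarrow> real) \<Rightarrow> (real \<Rightarrow> 'y metric) \<Rightarrow> (nat \<Rightarrow> 'y \<Rightarrow> 'y) \<Rightarrow> (nat \<Rightarrow> nat \<times> 'y) set metric" where
  "completed_glued_limit \<delta> Y \<psi> = completion (glued_points \<delta> Y \<psi>) (glued_dist \<delta> Y \<psi>)"


section \<open>Limit's inner unions\<close>

definition common_embedding ::
    "(nat \<Rightarrow> 'a riem) \<Rightarrow> 'x metric \<Rightarrow> 'z metric \<Rightarrow> (nat \<Rightarrow> (nat \<Rightarrow> 'a) set \<Rightarrow> 'z) \<Rightarrow> ('x \<Rightarrow> 'z) \<Rightarrow> bool" where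
  "common_embedding M X Z f g \<longleftrightarrow>
     compact_metric Z \<and>
     (\<forall>j. isometric_embedding (mcompletion (M j)) Z (f j)) \<and>
     isometric_embedding X Z g \<and>
     hausdorff_conv Z (\<lambda>j. f j ` mspace (mcompletion (M j))) (g ` mspace X)"

definition inner_limit ::
    "(nat \<Rightarrow> 'a riem) \<Rightarrow> 'x metric \<Rightarrow> 'z metric \<Rightarrow> (nat \<Rightarrow> (nat \<Rightarrow> 'a) set \<Rightarrow> 'z) \<Rightarrow> ('x \<Rightarrow> 'z) \<Rightarrow>
     (nat \<Rightarrow> nat) \<Rightarrow> real \<Rightarrow> 'z set \<Rightarrow> bool" where
  "inner_limit M X Z f g r \<delta> W \<longleftrightarrow>
     compactin (mtopology_of Z) W \<and> W \<subseteq> g ` mspace X \<and>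
     hausdorff_conv Z (\<lambda>k. f (r k) ` inner_in_completion (M (r k)) \<delta>) W"

definition inner_union_params ::
    "(nat \<Rightarrow> 'a riem) \<Rightarrow> 'x metric \<Rightarrow> 'z metric \<Rightarrow> (nat \<Rightarrow> (nat \<Rightarrow> 'a) set \<Rightarrow> 'z) \<Rightarrow> ('x \<Rightarrow> 'z) \<Rightarrow>
     (nat \<Rightarrow> nat) \<Rightarrow> real set" where
  "inner_union_params M X Z f g r = {\<delta>. \<delta> > 0 \<and> (\<exists>W. inner_limit M X Z f g r \<delta> W)}"

text \<open>The limit \<open>W\<close> is unique because compact sets are closed.\<close>

definition inner_union ::
    "(nat \<Rightarrow> 'a riem) \<Rightarrow> 'x metric \<Rightarrow> 'z metric \<Rightarrow> (nat \<Rightarrow> (nat \<Rightarrow> 'a) set \<Rightarrow> 'z) \<Rightarrow> ('x \<Rightarrow> 'z) \<Rightarrow>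
     (nat \<Rightarrow> nat) \<Rightarrow> 'x set" where
  "inner_union M X Z f g r =
     (\<Union>\<delta>\<in>inner_union_params M X Z f g r.
        {x \<in> mspace X. g x \<in> (THE W. inner_limit M X Z f g r \<delta> W)})"

end

theory Submission
  imports Defs
begin

text \<open>
Write \<open>S\<close> for the glued space with its metric \<open>d\<close>, and \<open>B \<subseteq> X\<close> for the closure of the inner
union. Both are exhausted by limits of inner regions: \<open>S\<close> by the pieces \<open>Y (\<delta> i)\<close>, and the inner
union by the Hausdorff limits \<open>W\<close> of the \<open>t\<close>-inner regions for admissible \<open>t\<close>. As the inner
regions grow when the parameter decreases, the two exhaustions interleave. Given \<open>i\<close>, choose an
admissible \<open>t \<le> \<delta> i\<close>: far out in the subsequence, \<open>Y (\<delta> i)\<close> is almost isometric to the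
\<open>\<delta> i\<close>-inner region, which lies in the \<open>t\<close>-inner region, which is close to \<open>W\<close>
(\<open>limit_embeds_in_inner_union\<close>). Given finitely many points of the inner union, choose \<open>i\<close> such that
\<open>\<delta> i\<close> is below all their parameters: far out in the subsequence, these points are close to points of
the \<open>\<delta> i\<close>-inner region, which is almost isometric to \<open>Y (\<delta> i)\<close> (\<open>inner_union_embeds_in_limit\<close>).

So each of \<open>S\<close> and \<open>B\<close> almost embeds, finite part by finite part, into the other. Compactness of
\<open>B\<close> turns this into an isometry between the completion of \<open>S\<close> and \<open>B\<close>
(\<open>isometric_completion_if_mutually_approximable\<close>): by Tychonoff's theorem \<open>S\<close> has an honest
isometric map \<open>h\<close> into \<open>B\<close>; again by Tychonoff, \<open>B\<close> embeds isometrically into the closure of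
\<open>h ` S\<close>, which is a compact subset of \<open>B\<close>; a compact space has no isometric embedding into a proper
subset of itself, so that \<open>h ` S\<close> is dense in \<open>B\<close>. This also explains why gluing along different
subsequences gives the same space: for any isometric embeddings \<open>\<psi> i\<close> of \<open>Y (\<delta> i)\<close> into
\<open>Y (\<delta> (i + 1))\<close>, the completed union is determined up to isometry by the pieces.

The Riemannian structure enters through the fact that the length metric is a pseudometric
(\<open>pseudometric_riem_dist\<close>), which makes the completions of the inner regions metric spaces. It rests on
concatenation and reversal of piecewise \<open>C\<^sup>1\<close> curves, on nonnegativity of length, and on connectedness.
\<close>

section \<open>Almost isometric maps and compactness\<close>

text \<open>
Additive distortion is the notion of approximation that composes: distortions add up along a chain of
maps, and such maps exist both between Gromov-Hausdorff close spaces and between Hausdorff close sets.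
The map is arbitrary, not necessarily continuous or injective.
\<close>

definition almost_embeds ::
    "'a set \<Rightarrow> ('a \<Rightarrow> 'a \<Rightarrow> real) \<Rightarrow> 'b set \<Rightarrow> ('b \<Rightarrow> 'b \<Rightarrow> real) \<Rightarrow> real \<Rightarrow> bool" where
  "almost_embeds S d T d' e \<longleftrightarrow> (\<exists>h\<in>S \<rightarrow> T. \<forall>x\<in>S. \<forall>y\<in>S. \<bar>d' (h x) (h y) - d x y\<bar> \<le> e)"

lemma almost_embeds_trans:
  assumes "almost_embeds S d T d' e" "almost_embeds T d' R d'' e'"
  shows "almost_embeds S d R d'' (e + e')"
proof -
  obtain h where h: "h \<in> S \<rightarrow> T" "\<forall>x\<in>S. \<forall>y\<in>S. \<bar>d' (h x) (h y) - d x y\<bar> \<le> e"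
    using assms(1) by (auto simp: almost_embeds_def)
  obtain k where k: "k \<in> T \<rightarrow> R" "\<forall>x\<in>T. \<forall>y\<in>T. \<bar>d'' (k x) (k y) - d' x y\<bar> \<le> e'"
    using assms(2) by (auto simp: almost_embeds_def)
  have "\<bar>d'' (k (h x)) (k (h y)) - d x y\<bar> \<le> e + e'" if "x \<in> S" "y \<in> S" for x y
  proof -
    have "h x \<in> T" "h y \<in> T" using h(1) that by auto
    then have "\<bar>d'' (k (h x)) (k (h y)) - d' (h x) (h y)\<bar> \<le> e'" using k(2) by blast
    moreover have "\<bar>d' (h x) (h y) - d x y\<bar> \<le> e" using h(2) that by blast
    ultimately show ?thesis by linarith
  qed
  moreover have "(\<lambda>x. k (h x)) \<in> S \<rightarrow> R" using h(1) k(1) by auto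
  ultimately show ?thesis unfolding almost_embeds_def by (intro bexI[of _ "\<lambda>x. k (h x)"]) auto
qed

lemma almost_embeds_mono:
  assumes "almost_embeds S d T d' e" "S' \<subseteq> S" "T \<subseteq> T'" "e \<le> e'"
  shows "almost_embeds S' d T' d' e'"
proof -
  obtain h where h: "h \<in> S \<rightarrow> T" "\<forall>x\<in>S. \<forall>y\<in>S. \<bar>d' (h x) (h y) - d x y\<bar> \<le> e"
    using assms(1) by (auto simp: almost_embeds_def)
  show ?thesis
    unfolding almost_embeds_def
  proof (intro bexI ballI)
    show "h \<in> S' \<rightarrow> T'" using h(1) assms by auto
    fix x y assume "x \<in> S'" "y \<in> S'"
    then have "\<bar>d' (h x) (h y) - d x y\<bar> \<le> e" using h(2) assms(2) by blast
    then show "\<bar>d' (h x) (h y) - d x y\<bar> \<le> e'" using assms(4) by linarith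
  qed
qed

lemma almost_embeds_isometric:
  assumes "\<And>x. x \<in> S \<Longrightarrow> h x \<in> T" "\<And>x y. x \<in> S \<Longrightarrow> y \<in> S \<Longrightarrow> d' (h x) (h y) = d x y"
  shows "almost_embeds S d T d' 0"
  using assms unfolding almost_embeds_def by (intro bexI[of _ h]) auto

text \<open>
Moving each point of \<open>S\<close> to a nearby point of \<open>T\<close> changes a distance by at most the two displacements.
\<close>

lemma almost_embeds_near:
  assumes "S \<subseteq> mspace X" "T \<subseteq> mspace X" and near: "\<And>x. x \<in> S \<Longrightarrow> \<exists>y\<in>T. mdist X x y < e"
  shows "almost_embeds S (mdist X) T (mdist X) (2 * e)"
proof -
  obtain p where p: "\<And>x. x \<in> S \<Longrightarrow> p x \<in> T \<and> mdist X x (p x) < e"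
    using near by metis
  interpret Metric_space "mspace X" "mdist X" by simp
  have "\<bar>mdist X (p x) (p y) - mdist X x y\<bar> \<le> 2 * e" if "x \<in> S" "y \<in> S" for x y
  proof -
    have m: "x \<in> mspace X" "y \<in> mspace X" "p x \<in> mspace X" "p y \<in> mspace X"
      using that p assms by auto
    have "mdist X (p x) (p y) \<le> mdist X (p x) x + mdist X x y + mdist X y (p y)"
      using triangle[of "p x" x "p y"] triangle[of x y "p y"] m by linarith
    moreover have "mdist X x y \<le> mdist X x (p x) + mdist X (p x) (p y) + mdist X (p y) y"
      using triangle[of x "p x" y] triangle[of "p x" "p y" y] m by linarith
    moreover have "mdist X x (p x) < e" "mdist X y (p y) < e" using p that by auto
    ultimately show ?thesis
      using commute[of x "p x"] commute[of y "p y"] by linarith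
  qed
  moreover have "p \<in> S \<rightarrow> T" using p by auto
  ultimately show ?thesis unfolding almost_embeds_def by (intro bexI[of _ p]) auto
qed

text \<open>
In the compact product \<open>(mspace B)\<^sup>S\<close>, the conditions ``the distance of \<open>h x\<close> and \<open>h y\<close> is within \<open>e\<close>
of \<open>d x y\<close>'' define closed sets. Finitely many of them involve finitely many points and a least \<open>e\<close>, so
they have a common solution; by compactness there is one map that satisfies all of them.
\<close>

lemma isometric_map_of_finite_approximations:
  fixes d :: "'a \<Rightarrow> 'a \<Rightarrow> real" and B :: "'b metric"
  assumes B: "compact_metric B"
    and approx: "\<And>F e. \<lbrakk>finite F; F \<subseteq> S; e > 0\<rbrakk> \<Longrightarrow> almost_embeds F d (mspace B) (mdist B) e"
  obtains h where "h \<in> S \<rightarrow> mspace B" "\<And>x y. \<lbrakk>x \<in> S; y \<in> S\<rbrakk> \<Longrightarrow> mdist B (h x) (h y) = d x y"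
proof -
  define P where "P = product_topology (\<lambda>_. mtopology_of B) S"
  define C where "C = (\<lambda>(x, y, e). {h \<in> topspace P. mdist B (h x) (h y) \<in> {d x y - e..d x y + e}})"
  define T where "T = S \<times> S \<times> {0::real<..}"
  have P: "compact_space P" "topspace P = (\<Pi>\<^sub>E x\<in>S. mspace B)"
    using B by (auto simp: P_def compact_space_product_topology)
  have closed: "closedin P (C t)" if "t \<in> T" for t
  proof -
    obtain x y e where t: "t = (x, y, e)" "x \<in> S" "y \<in> S" using \<open>t \<in> T\<close> T_def by auto
    have "continuous_map P euclideanreal (\<lambda>h. mdist B (h x) (h y))"
      unfolding P_def using t by (intro continuous_map_mdist continuous_map_product_projection)
    then show ?thesis
      unfolding t C_def prod.case by (rule closedin_continuous_map_preimage) simp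
  qed
  have fin: "topspace P \<inter> \<Inter>(C ` G) \<noteq> {}" if G: "finite G" "G \<subseteq> T" for G
  proof -
    define F where "F = fst ` G \<union> (fst \<circ> snd) ` G"
    have F: "finite F" "F \<subseteq> S" using G by (auto simp: F_def T_def)
    define e where "e = Min (insert 1 ((snd \<circ> snd) ` G))"
    have "e > 0" unfolding e_def using G by (subst Min_gr_iff) (auto simp: T_def)
    have e: "e \<le> s" if "(x, y, s) \<in> G" for x y s
    proof -
      have "s \<in> (snd \<circ> snd) ` G" using image_eqI[OF _ that, of s "snd \<circ> snd"] by simp
      then show ?thesis unfolding e_def using G(1) by (intro Min_le) auto
    qed
    obtain k where k: "k \<in> F \<rightarrow> mspace B" "\<forall>x\<in>F. \<forall>y\<in>F. \<bar>mdist B (k x) (k y) - d x y\<bar> \<le> e"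
      using approx[OF F \<open>e > 0\<close>] by (auto simp: almost_embeds_def)
    \<comment> \<open>off the finite set, any point of the target will do\<close>
    have "\<exists>b. x \<in> S \<longrightarrow> b \<in> mspace B" if "x \<in> S" for x
      using approx[of "{x}" 1] that by (auto simp: almost_embeds_def)
    then obtain b where b: "\<And>x. x \<in> S \<Longrightarrow> b x \<in> mspace B" by metis
    define h where "h = (\<lambda>x\<in>S. if x \<in> F then k x else b x)"
    have "h \<in> topspace P" unfolding P h_def using k(1) b by auto
    moreover have "h \<in> C t" if t: "t \<in> G" for t
    proof -
      obtain x y s where tt: "t = (x, y, s)" by (cases t)
      have "x \<in> fst ` G" "y \<in> (fst \<circ> snd) ` G"
        using image_eqI[OF _ t, of x fst] image_eqI[OF _ t, of y "fst \<circ> snd"] by (simp_all add: tt)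
      then have xy: "x \<in> F" "y \<in> F" by (simp_all add: F_def)
      have "\<bar>mdist B (k x) (k y) - d x y\<bar> \<le> e" using k(2) xy by blast
      also have "e \<le> s" using e t tt by blast
      finally have "\<bar>mdist B (k x) (k y) - d x y\<bar> \<le> s" .
      moreover have "h x = k x" "h y = k y" using xy F by (auto simp: h_def)
      ultimately have "mdist B (h x) (h y) \<in> {d x y - s..d x y + s}" by (simp add: abs_le_iff)
      then show ?thesis
        using \<open>h \<in> topspace P\<close> by (simp add: C_def tt)
    qed
    ultimately show ?thesis by blast
  qed
  have "topspace P \<inter> \<Inter>(C ` T) \<noteq> {}"
  proof (cases "T = {}")
    case True
    then show ?thesis using fin[of "{}"] by simp
  next
    case False
    have "\<Inter>(C ` T) \<noteq> {}"
    proof (rule P(1)[unfolded compact_space_fip, rule_format, of "C ` T"], intro conjI ballI allI impI)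
      fix \<F> assume "finite \<F> \<and> \<F> \<subseteq> C ` T"
      then obtain G where "G \<subseteq> T" "finite G" "\<F> = C ` G" using finite_subset_image by meson
      then show "\<Inter>\<F> \<noteq> {}" using fin by blast
    qed (use closed in blast)
    moreover have "\<Inter>(C ` T) \<subseteq> topspace P" using False by (auto simp: C_def)
    ultimately show ?thesis by auto
  qed
  then obtain h where h: "h \<in> topspace P" "\<And>t. t \<in> T \<Longrightarrow> h \<in> C t" by blast
  have "mdist B (h x) (h y) = d x y" if "x \<in> S" "y \<in> S" for x y
  proof -
    have "\<bar>mdist B (h x) (h y) - d x y\<bar> \<le> 0"
    proof (rule field_le_epsilon)
      fix e :: real assume "e > 0"
      then have "h \<in> C (x, y, e)" using h(2) \<open>x \<in> S\<close> \<open>y \<in> S\<close> by (simp add: T_def)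
      then show "\<bar>mdist B (h x) (h y) - d x y\<bar> \<le> 0 + e" by (simp add: C_def abs_le_iff)
    qed
    then show ?thesis by simp
  qed
  moreover have "h \<in> S \<rightarrow> mspace B" using h(1) P by auto
  ultimately show thesis using that by blast
qed

lemma in_closure_iff_near:
  "x \<in> mtopology_of X closure_of S \<longleftrightarrow>
     x \<in> mspace X \<and> (\<forall>e>0. \<exists>y\<in>S. y \<in> mspace X \<and> mdist X x y < e)"
proof -
  interpret Metric_space "mspace X" "mdist X" by simp
  show ?thesis by (auto simp: mtopology_of_def metric_closure_of)
qed

text \<open>
An orbit \<open>y, h y, h (h y), \<dots>\<close> in a compact space has two terms that are arbitrarily close. Since \<open>h\<close>
preserves distances, both can be moved back until the first one is \<open>y\<close>, and the second is still in the
image of \<open>h\<close>. So the image is dense, and it is compact, hence closed.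
\<close>

lemma isometric_self_embedding_onto:
  assumes B: "compact_metric B" and h: "isometric_embedding B B h"
  shows "h ` mspace B = mspace B"
proof
  interpret Metric_space "mspace B" "mdist B" by simp
  show "h ` mspace B \<subseteq> mspace B" using h by (auto simp: isometric_embedding_def)
  have hB: "h x \<in> mspace B" if "x \<in> mspace B" for x
    using h that by (auto simp: isometric_embedding_def)
  have hd: "mdist B (h x) (h y) = mdist B x y" if "x \<in> mspace B" "y \<in> mspace B" for x y
    using h that by (auto simp: isometric_embedding_def)
  have pow: "(h ^^ n) x \<in> mspace B" if "x \<in> mspace B" for n x
    by (induction n) (use that hB in auto)
  have pd: "mdist B ((h ^^ n) x) ((h ^^ n) y) = mdist B x y"
    if "x \<in> mspace B" "y \<in> mspace B" for n x y
    by (induction n) (use that hd pow in auto)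
  show "mspace B \<subseteq> h ` mspace B"
  proof
    fix y assume y: "y \<in> mspace B"
    \<comment> \<open>the orbit of \<open>y\<close> has a Cauchy subsequence, so it returns arbitrarily close to \<open>y\<close>\<close>
    have close: "\<exists>z\<in>h ` mspace B. mdist B y z < e" if "e > 0" for e
    proof -
      have "range (\<lambda>n. (h ^^ n) y) \<subseteq> mspace B" using pow y by auto
      then obtain l s where s: "strict_mono s" "limitin mtopology ((\<lambda>n. (h ^^ n) y) \<circ> s) l sequentially"
        using B unfolding mtopology_of_def compact_space_sequentially by blast
      then have "l \<in> mspace B"
        and "\<exists>N. \<forall>n\<ge>N. (h ^^ s n) y \<in> mspace B \<and> mdist B ((h ^^ s n) y) l < e / 2"
        using half_gt_zero[OF that] unfolding limit_metric_sequentially o_def by blast+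
      then obtain N where N: "\<And>n. n \<ge> N \<Longrightarrow> mdist B ((h ^^ s n) y) l < e / 2" by blast
      define p where "p = s N"
      have "s N < s (Suc N)" using s(1) by (simp add: strict_mono_Suc_iff)
      then obtain q where q: "s (Suc N) = p + Suc q"
        unfolding p_def using less_iff_Suc_add by auto
      have "mdist B ((h ^^ s N) y) ((h ^^ s (Suc N)) y) < e"
        using triangle[of "(h ^^ s N) y" l "(h ^^ s (Suc N)) y"] N[of N] N[of "Suc N"]
          commute[of l "(h ^^ s (Suc N)) y"] pow[OF y] \<open>l \<in> mspace B\<close> by auto
      moreover have "(h ^^ s (Suc N)) y = (h ^^ p) ((h ^^ Suc q) y)"
        unfolding q funpow_add by simp
      ultimately have "mdist B y ((h ^^ Suc q) y) < e"
        using pd[OF y pow[OF y, of "Suc q"], of p] by (simp add: p_def)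
      moreover have "(h ^^ Suc q) y \<in> h ` mspace B" using pow[OF y, of q] by simp
      ultimately show ?thesis by blast
    qed
    have "continuous_map (mtopology_of B) (mtopology_of B) h"
      using hB hd by (intro Lipschitz_continuous_imp_continuous_map)
        (simp add: Lipschitz_continuous_map_def, rule exI[of _ 1], simp)
    then have "compactin (mtopology_of B) (h ` mspace B)"
      using B image_compactin unfolding compact_space_def by fastforce
    then have "closedin (mtopology_of B) (h ` mspace B)"
      by (intro compactin_imp_closedin) (auto simp: mtopology_of_def Hausdorff_space_mtopology)
    moreover have "y \<in> mtopology_of B closure_of (h ` mspace B)"
      unfolding in_closure_iff_near using close y hB by blast
    ultimately show "y \<in> h ` mspace B" using closure_of_closedin by blast
  qed
qed

section \<open>Completions\<close>

text \<open>
A Cauchy sequence in \<open>S\<close> is mapped by \<open>h\<close> to a convergent sequence, and its limit is the image of the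
class. Every point of the closure arises in this way, because a sequence in \<open>S\<close> whose images converge
is a Cauchy sequence. That \<open>d\<close> is a pseudometric follows from the existence of \<open>h\<close>.
\<close>

lemma isometric_completion_closure:
  fixes B :: "'b metric" and d :: "'a \<Rightarrow> 'a \<Rightarrow> real"
  assumes B: "compact_metric B" and hS: "h \<in> S \<rightarrow> mspace B"
    and hd: "\<And>x y. \<lbrakk>x \<in> S; y \<in> S\<rbrakk> \<Longrightarrow> mdist B (h x) (h y) = d x y"
  shows "isometric (completion S d) (submetric B (mtopology_of B closure_of (h ` S)))"
proof -
  interpret Metric_space "mspace B" "mdist B" by simp
  have hB: "h x \<in> mspace B" if "x \<in> S" for x using hS that by auto
  interpret S: pseudometric_on S d
  proof
    show "d x x = 0" if "x \<in> S" for x using hd[OF that that] hB[OF that] by simp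
    show "d x y = d y x" if "x \<in> S" "y \<in> S" for x y
      using hd that commute[of "h x" "h y"] by metis
    show "d x z \<le> d x y + d y z" if "x \<in> S" "y \<in> S" "z \<in> S" for x y z
      using triangle[of "h x" "h y" "h z"] that by (simp add: hd hB)
  qed
  interpret C: Metric_space "completion_points S d" "completion_dist S d"
    by (rule S.Metric_space_completion)
  have complete: mcomplete using B compact_space_imp_mcomplete by (simp add: mtopology_of_def)
  have "\<exists>x l. x \<in> cauchy_seqs S d \<and> p = cauchy_class S d x \<and> l \<in> mspace B \<and>
      (\<lambda>n. mdist B (h (x n)) l) \<longlonglongrightarrow> 0" if p: "p \<in> completion_points S d" for p
  proof -
    obtain x where x: "x \<in> cauchy_seqs S d" "p = cauchy_class S d x"
      using p by (auto simp: completion_points_def)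
    have "MCauchy (\<lambda>n. h (x n))"
      using x(1) hB by (auto simp: MCauchy_def cauchy_seqs_def hd range_subsetD)
    then obtain l where "limitin mtopology (\<lambda>n. h (x n)) l sequentially"
      using complete unfolding mcomplete_def by blast
    then show ?thesis using x unfolding limitin_metric_dist_null by blast
  qed
  then obtain x l where x: "\<And>p. p \<in> completion_points S d \<Longrightarrow> x p \<in> cauchy_seqs S d"
      "\<And>p. p \<in> completion_points S d \<Longrightarrow> p = cauchy_class S d (x p)"
    and l: "\<And>p. p \<in> completion_points S d \<Longrightarrow> l p \<in> mspace B"
      "\<And>p. p \<in> completion_points S d \<Longrightarrow> (\<lambda>n. mdist B (h (x p n)) (l p)) \<longlonglongrightarrow> 0"
    by metis
  have lim: "(\<lambda>n. d (u n) (v n)) \<longlonglongrightarrow> mdist B a b"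
    if u: "\<And>n. u n \<in> S" "(\<lambda>n. mdist B (h (u n)) a) \<longlonglongrightarrow> 0" "a \<in> mspace B"
      and v: "\<And>n. v n \<in> S" "(\<lambda>n. mdist B (h (v n)) b) \<longlonglongrightarrow> 0" "b \<in> mspace B" for u v a b
  proof -
    interpret T: pseudometric_on "mspace B" "mdist B"
      by unfold_locales (auto simp: commute triangle)
    have "(\<lambda>n. mdist B (h (u n)) a + mdist B (h (v n)) b) \<longlonglongrightarrow> 0"
      using tendsto_add[OF u(2) v(2)] by simp
    then have "(\<lambda>n. d (u n) (v n) - mdist B a b) \<longlonglongrightarrow> 0"
      by (rule Lim_null_comparison[rotated])
        (use T.quad[OF hB[OF u(1)] hB[OF v(1)] u(3) v(3)] u(1) v(1) in
          \<open>auto simp: hd intro!: always_eventually\<close>)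
    then show ?thesis by (simp add: LIM_zero_iff)
  qed
  show ?thesis
    unfolding isometric_def isometric_embedding_def
  proof (intro exI conjI)
    let ?cl = "mtopology_of B closure_of (h ` S)"
    have cl: "l p \<in> ?cl" if p: "p \<in> completion_points S d" for p
      unfolding in_closure_iff_near
    proof (intro conjI allI impI)
      fix e :: real assume "e > 0"
      then obtain n where "mdist B (h (x p n)) (l p) < e"
        using order_tendstoD(2)[OF l(2)[OF p], of e] by (auto simp: eventually_sequentially)
      then show "\<exists>y\<in>h ` S. y \<in> mspace B \<and> mdist B (l p) y < e"
        using S.cauchy_in[OF x(1)[OF p], of n] hB
        by (intro bexI[of _ "h (x p n)"]) (auto simp: commute)
    qed (use l p in auto)
    show "l \<in> mspace (completion S d) \<rightarrow> mspace (submetric B ?cl)"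
      using l cl by (auto simp: completion_def)
    show "\<forall>p\<in>mspace (completion S d). \<forall>q\<in>mspace (completion S d).
        mdist (submetric B ?cl) (l p) (l q) = mdist (completion S d) p q"
    proof (intro ballI)
      fix p q assume "p \<in> mspace (completion S d)" "q \<in> mspace (completion S d)"
      then have pq: "p \<in> completion_points S d" "q \<in> completion_points S d"
        by (auto simp: completion_def)
      have "(\<lambda>n. d (x p n) (x q n)) \<longlonglongrightarrow> mdist B (l p) (l q)"
        using pq by (intro lim l S.cauchy_in x) auto
      then show "mdist (submetric B ?cl) (l p) (l q) = mdist (completion S d) p q"
        using S.completion_dist_eq[OF x(1) x(1)] pq x(2)[symmetric] by (simp add: completion_def)
    qed
    show "l ` mspace (completion S d) = mspace (submetric B ?cl)"
    proof
      show "l ` mspace (completion S d) \<subseteq> mspace (submetric B ?cl)"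
        using l cl by (auto simp: completion_def)
      show "mspace (submetric B ?cl) \<subseteq> l ` mspace (completion S d)"
      proof
        fix b assume "b \<in> mspace (submetric B ?cl)"
        then have b: "b \<in> mspace B" "\<And>e. e > 0 \<Longrightarrow> \<exists>y\<in>S. mdist B b (h y) < e"
          by (auto simp: in_closure_iff_near)
        have "\<exists>y\<in>S. mdist B b (h y) < inverse (real (Suc n))" for n
          using b(2) by (simp del: of_nat_Suc)
        then obtain y where y: "\<And>n. y n \<in> S" "\<And>n. mdist B b (h (y n)) < inverse (real (Suc n))"
          by metis
        have y0: "(\<lambda>n. mdist B (h (y n)) b) \<longlonglongrightarrow> 0"
          by (rule real_tendsto_sandwich[OF _ _ tendsto_const LIMSEQ_inverse_real_of_nat])
            (auto intro!: always_eventually less_imp_le simp: commute y(2) simp del: of_nat_Suc)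
        then have "limitin mtopology (\<lambda>n. h (y n)) b sequentially"
          unfolding limitin_metric_dist_null using b y hB by (auto intro!: always_eventually)
        then have "MCauchy (\<lambda>n. h (y n))"
          by (rule convergent_imp_MCauchy[rotated]) (use y hB in auto)
        then have yc: "y \<in> cauchy_seqs S d"
          using y(1) by (auto simp: MCauchy_def cauchy_seqs_def hd)
        define p where "p = cauchy_class S d y"
        have p: "p \<in> completion_points S d" using yc by (auto simp: p_def completion_points_def)
        have "(\<lambda>n. d (x p n) (y n)) \<longlonglongrightarrow> mdist B (l p) b"
          by (rule lim[OF S.cauchy_in[OF x(1)[OF p]] l(2)[OF p] l(1)[OF p] y(1) y0 b(1)])
        moreover have "(\<lambda>n. d (x p n) (y n)) \<longlonglongrightarrow> 0"
          using S.class_eq[OF x(1)[OF p] yc] x(2)[OF p] p_def by simp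
        ultimately have "mdist B (l p) b = 0" using LIMSEQ_unique by blast
        then have "l p = b" using l(1)[OF p] b(1) by simp
        then show "b \<in> l ` mspace (completion S d)" using p by (auto simp: completion_def)
      qed
    qed
  qed
qed

lemma cauchy_seqs_mono: "T \<subseteq> S \<Longrightarrow> cauchy_seqs T d \<subseteq> cauchy_seqs S d"
  by (auto simp: cauchy_seqs_def)

text \<open>
The union in \<open>completion_incl\<close> is one over equal sets: equivalent Cauchy sequences of \<open>T\<close> have the same
class in \<open>S\<close>.
\<close>

lemma completion_incl_class:
  assumes "pseudometric_on S d" and "T \<subseteq> S" and "x \<in> cauchy_seqs T d"
  shows "completion_incl S d (cauchy_class T d x) = cauchy_class S d x"
proof -
  interpret S: pseudometric_on S d by fact
  have sub: "cauchy_seqs T d \<subseteq> cauchy_seqs S d" by (rule cauchy_seqs_mono[OF assms(2)])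
  interpret T: pseudometric_on T d
    using assms(2) by unfold_locales (auto intro: S.refl S.sym S.tri)
  show ?thesis
  proof
    show "cauchy_class S d x \<subseteq> completion_incl S d (cauchy_class T d x)"
      unfolding completion_incl_def using T.self_in_class[OF assms(3)] by blast
    have "cauchy_class S d y = cauchy_class S d x" if "y \<in> cauchy_class T d x" for y
    proof -
      have "y \<in> cauchy_seqs T d" "(\<lambda>n. d (x n) (y n)) \<longlonglongrightarrow> 0"
        using that by (auto simp: cauchy_class_def)
      then show ?thesis using S.class_eq[of x y] sub assms(3) by auto
    qed
    then show "completion_incl S d (cauchy_class T d x) \<subseteq> cauchy_class S d x"
      unfolding completion_incl_def by blast
  qed
qed

lemma
  assumes "pseudometric_on S d"
  shows mspace_completion: "mspace (completion S d) = completion_points S d"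
    and mdist_completion: "mdist (completion S d) = completion_dist S d"
proof -
  interpret Metric_space "completion_points S d" "completion_dist S d"
    by (rule pseudometric_on.Metric_space_completion[OF assms])
  show "mspace (completion S d) = completion_points S d"
    "mdist (completion S d) = completion_dist S d" by (simp_all add: completion_def)
qed

lemma pseudometric_on_subset: "pseudometric_on S d \<Longrightarrow> T \<subseteq> S \<Longrightarrow> pseudometric_on T d"
  unfolding pseudometric_on_def by (meson subsetD)

lemma image_completion_incl:
  assumes "pseudometric_on S d" and "T \<subseteq> S"
  shows "completion_incl S d ` mspace (completion T d) = cauchy_class S d ` cauchy_seqs T d"
  using completion_incl_class[OF assms]
  by (simp add: mspace_completion[OF pseudometric_on_subset[OF assms]] completion_points_def image_image)

lemma completion_incl_isometric:
  assumes S: "pseudometric_on S d" and TS: "T \<subseteq> S"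
  shows "isometric_embedding (completion T d) (completion S d) (completion_incl S d)"
  unfolding isometric_embedding_def
proof (intro conjI ballI)
  interpret S: pseudometric_on S d by fact
  note T = pseudometric_on_subset[OF assms]
  have sub: "cauchy_seqs T d \<subseteq> cauchy_seqs S d" by (rule cauchy_seqs_mono[OF TS])
  then have "completion_incl S d ` mspace (completion T d) \<subseteq> mspace (completion S d)"
    by (auto simp: image_completion_incl[OF assms] mspace_completion[OF S] completion_points_def)
  then show "completion_incl S d \<in> mspace (completion T d) \<rightarrow> mspace (completion S d)" by blast
  fix p q assume "p \<in> mspace (completion T d)" "q \<in> mspace (completion T d)"
  then obtain x y where xy: "x \<in> cauchy_seqs T d" "y \<in> cauchy_seqs T d"
    "p = cauchy_class T d x" "q = cauchy_class T d y"
    by (auto simp: mspace_completion[OF T] completion_points_def)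
  obtain l where l: "(\<lambda>n. d (x n) (y n)) \<longlonglongrightarrow> l"
    using pseudometric_on.dist_convergent[OF T xy(1,2)] by blast
  then show "mdist (completion S d) (completion_incl S d p) (completion_incl S d q)
      = mdist (completion T d) p q"
    using pseudometric_on.completion_dist_eq[OF T xy(1,2) l]
      S.completion_dist_eq[OF _ _ l] xy sub
    by (auto simp: completion_incl_class[OF assms] mdist_completion[OF S] mdist_completion[OF T])
qed

lemma compact_submetric_closure:
  assumes "compact_metric X"
  shows "compact_metric (submetric X (mtopology_of X closure_of S))"
  unfolding mtopology_of_submetric
  by (intro compact_space_subtopology closedin_compact_space assms closedin_closure_of)

text \<open>
A substitute for uniqueness of compact Gromov-Hausdorff limits that needs compactness of one side only:
the completion of \<open>S\<close> becomes compact by being identified with a closed subset of \<open>B\<close>.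
\<close>

theorem isometric_completion_if_mutually_approximable:
  fixes d :: "'a \<Rightarrow> 'a \<Rightarrow> real" and B :: "'b metric"
  assumes B: "compact_metric B"
    and SB: "\<And>F e. \<lbrakk>finite F; F \<subseteq> S; e > 0\<rbrakk> \<Longrightarrow> almost_embeds F d (mspace B) (mdist B) e"
    and BS: "\<And>F e. \<lbrakk>finite F; F \<subseteq> mspace B; e > 0\<rbrakk> \<Longrightarrow> almost_embeds F (mdist B) S d e"
  shows "isometric (completion S d) B"
proof -
  obtain h where h: "h \<in> S \<rightarrow> mspace B" "\<And>x y. \<lbrakk>x \<in> S; y \<in> S\<rbrakk> \<Longrightarrow> mdist B (h x) (h y) = d x y"
    using isometric_map_of_finite_approximations[OF B SB] by blast
  define C where "C = submetric B (mtopology_of B closure_of (h ` S))"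
  have C: "mspace C \<subseteq> mspace B" "mdist C = mdist B" by (simp_all add: C_def)
  have hC: "h ` S \<subseteq> mspace C"
    using h(1) closure_of_subset[of "h ` S" "mtopology_of B"] by (auto simp: C_def)
  have SC: "almost_embeds S d (mspace C) (mdist C) 0"
    by (rule almost_embeds_isometric[of _ h]) (use hC h(2) C(2) in auto)
  \<comment> \<open>the composite of the given almost embeddings of \<open>B\<close> into \<open>S\<close> with \<open>h\<close> stays in \<open>C\<close>\<close>
  have BC: "almost_embeds F (mdist B) (mspace C) (mdist C) e"
    if "finite F" "F \<subseteq> mspace B" "e > 0" for F e
    using almost_embeds_trans[OF BS[OF that] SC] by simp
  have "compact_metric C" unfolding C_def by (rule compact_submetric_closure[OF B])
  then obtain k where k: "k \<in> mspace B \<rightarrow> mspace C"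
      "\<And>x y. \<lbrakk>x \<in> mspace B; y \<in> mspace B\<rbrakk> \<Longrightarrow> mdist C (k x) (k y) = mdist B x y"
    using isometric_map_of_finite_approximations[OF _ BC] by blast
  then have "isometric_embedding B B k" using C by (auto simp: isometric_embedding_def)
  from isometric_self_embedding_onto[OF B this] have "k ` mspace B = mspace B" .
  moreover have "k ` mspace B \<subseteq> mspace C" using k(1) by blast
  ultimately have "mspace B \<subseteq> mspace C" by simp
  then have "mtopology_of B closure_of (h ` S) = mspace B"
    using closure_of_subset_topspace[of "mtopology_of B" "h ` S"] by (auto simp: C_def)
  then show ?thesis
    using isometric_completion_closure[OF B h] by (simp add: submetric_mspace)
qed

section \<open>The length metric\<close>

text \<open>
A shift (\<open>\<sigma> = 1\<close>) or a reversal (\<open>\<sigma> = -1\<close>) of the parameter multiplies the velocity by \<open>\<sigma>\<close>, and the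
speed is quadratic in the velocity under the root, so that it is only transported. The curve \<open>\<gamma>'\<close> is
given by its values on the interval, because in a concatenation it is only a part of a longer curve.
\<close>

lemma C1_curve_reparametrize:
  fixes \<gamma> \<gamma>' :: "real \<Rightarrow> 'a" and \<sigma> k :: real
  assumes uv: "u < v" "u' < v'" and C1: "C1_in_chart M c {u..v} \<gamma>"
    and \<sigma>: "\<sigma> = 1 \<or> \<sigma> = -1" and im: "(\<lambda>t. \<sigma> * t + k) ` {u'..v'} = {u..v}"
    and eq: "\<And>t. t \<in> {u'..v'} \<Longrightarrow> \<gamma>' t = \<gamma> (\<sigma> * t + k)"
  shows "C1_in_chart M c {u'..v'} \<gamma>'"
    and "integral {u'..v'} (speed_in_chart M c {u'..v'} \<gamma>') =
      integral {u..v} (speed_in_chart M c {u..v} \<gamma>)"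
proof -
  define \<phi> where "\<phi> t = \<sigma> * t + k" for t
  have \<phi>im: "\<phi> ` {u'..v'} = {u..v}" unfolding \<phi>_def by (rule im)
  then have \<phi>I: "\<phi> t \<in> {u..v}" if "t \<in> {u'..v'}" for t using that by blast
  have der: "((\<lambda>s. snd c (\<gamma>' s) i) has_real_derivative D * \<sigma>) (at t within {u'..v'})"
    if "((\<lambda>s. snd c (\<gamma> s) i) has_real_derivative D) (at (\<phi> t) within {u..v})" "t \<in> {u'..v'}"
    for i t D
  proof -
    have "(\<phi> has_real_derivative \<sigma>) (at t within {u'..v'})"
      unfolding \<phi>_def by (auto intro!: derivative_eq_intros)
    then have "(((\<lambda>s. snd c (\<gamma> s) i) \<circ> \<phi>) has_real_derivative D * \<sigma>) (at t within {u'..v'})"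
      using DERIV_image_chain[of "\<lambda>s. snd c (\<gamma> s) i" D \<phi> t "{u'..v'}"] that \<phi>im by simp
    then show ?thesis
      by (rule has_field_derivative_transform_within[where d = 1])
        (use that eq in \<open>auto simp: \<phi>_def\<close>)
  qed
  have ex: "\<exists>w. continuous_on {u..v} w \<and>
      (\<forall>t\<in>{u..v}. ((\<lambda>s. snd c (\<gamma> s) i) has_real_derivative w t) (at t within {u..v}))"
    if "i < mandim M" for i
    using C1 that by (auto simp: C1_in_chart_def)
  show "C1_in_chart M c {u'..v'} \<gamma>'"
    unfolding C1_in_chart_def
  proof (intro conjI allI impI)
    have "\<gamma> ` {u..v} \<subseteq> fst c" using C1 by (simp add: C1_in_chart_def)
    then show "\<gamma>' ` {u'..v'} \<subseteq> fst c" using eq \<phi>I unfolding \<phi>_def by fastforce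
    fix i assume "i < mandim M"
    then obtain w where w: "continuous_on {u..v} w"
      "\<And>t. t \<in> {u..v} \<Longrightarrow> ((\<lambda>s. snd c (\<gamma> s) i) has_real_derivative w t) (at t within {u..v})"
      using ex by blast
    have "continuous_on {u'..v'} \<phi>" unfolding \<phi>_def by (intro continuous_intros)
    then have "continuous_on {u'..v'} (w \<circ> \<phi>)"
      using w(1) \<phi>im by (intro continuous_on_compose) auto
    then have "continuous_on {u'..v'} (\<lambda>t. w (\<phi> t) * \<sigma>)"
      unfolding o_def by (intro continuous_intros)
    then show "\<exists>w. continuous_on {u'..v'} w \<and>
        (\<forall>t\<in>{u'..v'}. ((\<lambda>s. snd c (\<gamma>' s) i) has_real_derivative w t) (at t within {u'..v'}))"
      using der w(2) \<phi>I by (intro exI[of _ "\<lambda>t. w (\<phi> t) * \<sigma>"]) blast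
  qed
  have vd: "vector_derivative (\<lambda>s. snd c (\<gamma>' s) i) (at t within {u'..v'}) =
      vector_derivative (\<lambda>s. snd c (\<gamma> s) i) (at (\<phi> t) within {u..v}) * \<sigma>"
    if t: "t \<in> {u'..v'}" and "i < mandim M" for i t
  proof -
    obtain D where D: "((\<lambda>s. snd c (\<gamma> s) i) has_real_derivative D) (at (\<phi> t) within {u..v})"
      using ex[OF \<open>i < mandim M\<close>] \<phi>I[OF t] by blast
    have "vector_derivative (\<lambda>s. snd c (\<gamma> s) i) (at (\<phi> t) within {u..v}) = D"
      using D uv(1) \<phi>I[OF t] by (intro vector_derivative_within_closed_interval)
        (auto simp: has_real_derivative_iff_has_vector_derivative)
    moreover have "vector_derivative (\<lambda>s. snd c (\<gamma>' s) i) (at t within {u'..v'}) = D * \<sigma>"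
      using der[OF D t] uv(2) t by (intro vector_derivative_within_closed_interval)
        (auto simp: has_real_derivative_iff_has_vector_derivative)
    ultimately show ?thesis by simp
  qed
  have speed: "speed_in_chart M c {u'..v'} \<gamma>' t = speed_in_chart M c {u..v} \<gamma> (\<phi> t)"
    if t: "t \<in> {u'..v'}" for t
  proof -
    have "\<sigma> * \<sigma> = 1" using \<sigma> by auto
    then have "x * (y * \<sigma>) * (z * \<sigma>) = x * y * z" for x y z :: real
      by (metis mult.assoc mult.commute mult_1)
    then show ?thesis
      unfolding speed_in_chart_def using t eq[OF t]
      by (intro arg_cong[where f = sqrt] sum.cong refl) (simp add: vd \<phi>_def)
  qed
  have aff: "((\<lambda>x. h (\<sigma> * x + k')) has_integral y) ((\<lambda>x. \<sigma> * x - \<sigma> * k') ` {a..b})"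
    if "(h has_integral y) {a..b}" for h :: "real \<Rightarrow> real" and y a b k'
    using has_integral_affinity[of h y a b \<sigma> k'] that \<sigma> by auto
  have inv: "(\<lambda>x. \<sigma> * x - \<sigma> * k) ` {u..v} = {u'..v'}"
    unfolding im[symmetric] image_image using \<sigma> by (auto simp: algebra_simps)
  have "(speed_in_chart M c {u..v} \<gamma> has_integral y) {u..v} \<longleftrightarrow>
      ((\<lambda>t. speed_in_chart M c {u..v} \<gamma> (\<phi> t)) has_integral y) {u'..v'}" for y
  proof
    show "((\<lambda>t. speed_in_chart M c {u..v} \<gamma> (\<phi> t)) has_integral y) {u'..v'}"
      if "(speed_in_chart M c {u..v} \<gamma> has_integral y) {u..v}"
      using aff[OF that, of k] by (simp add: inv \<phi>_def)
    assume "((\<lambda>t. speed_in_chart M c {u..v} \<gamma> (\<phi> t)) has_integral y) {u'..v'}"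
    from aff[OF this, of "- \<sigma> * k"] \<sigma>
    show "(speed_in_chart M c {u..v} \<gamma> has_integral y) {u..v}"
      by (auto simp: \<phi>_def im[symmetric])
  qed
  then have "integral {u..v} (speed_in_chart M c {u..v} \<gamma>) =
      integral {u'..v'} (\<lambda>t. speed_in_chart M c {u..v} \<gamma> (\<phi> t))"
    unfolding integral_def integrable_on_def by presburger
  also have "\<dots> = integral {u'..v'} (speed_in_chart M c {u'..v'} \<gamma>')"
    by (rule integral_cong) (simp only: speed)
  finally show "integral {u'..v'} (speed_in_chart M c {u'..v'} \<gamma>') =
      integral {u..v} (speed_in_chart M c {u..v} \<gamma>)" by simp
qed

text \<open>
The same lengths as those of \<open>has_riem_length\<close>, but without a common parameter: the pieces may live on
unrelated intervals. Concatenation and reversal are then inductions, and parameters have to be matched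
only once, in \<open>has_riem_length_if_curve_chain\<close>.
\<close>

inductive curve_chain :: "'a riem \<Rightarrow> 'a \<Rightarrow> 'a \<Rightarrow> real \<Rightarrow> bool" for M where
  empty: "curve_chain M x x 0"
| step: "\<lbrakk>curve_chain M x (\<gamma> u) L; c \<in> atlas M; u < v; C1_in_chart M c {u..v} \<gamma>\<rbrakk> \<Longrightarrow>
    curve_chain M x (\<gamma> v) (L + integral {u..v} (speed_in_chart M c {u..v} \<gamma>))"

lemma curve_chain_if_has_riem_length:
  assumes "has_riem_length M \<gamma> a b L"
  shows "curve_chain M (\<gamma> a) (\<gamma> b) L"
proof -
  obtain m t c where *: "t 0 = a" "t m = b"
    "\<And>i. i < m \<Longrightarrow> t i < t (Suc i) \<and> c i \<in> atlas M \<and> C1_in_chart M (c i) {t i..t (Suc i)} \<gamma>"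
    "L = (\<Sum>i<m. integral {t i..t (Suc i)} (speed_in_chart M (c i) {t i..t (Suc i)} \<gamma>))"
    using assms by (auto simp: has_riem_length_def)
  have "curve_chain M (\<gamma> (t 0)) (\<gamma> (t n))
      (\<Sum>i<n. integral {t i..t (Suc i)} (speed_in_chart M (c i) {t i..t (Suc i)} \<gamma>))"
    if "n \<le> m" for n
    using that
  proof (induction n)
    case 0
    then show ?case by (simp add: curve_chain.empty)
  next
    case (Suc n)
    then show ?case using curve_chain.step[of M "\<gamma> (t 0)" \<gamma> "t n"] *(3)[of n] by simp
  qed
  from this[of m] show ?thesis using * by simp
qed

text \<open>
The new piece is shifted so that it starts where the curve built so far ends.
\<close>

lemma has_riem_length_if_curve_chain:
  assumes "curve_chain M x y L"
  shows "\<exists>\<gamma> a b. \<gamma> a = x \<and> \<gamma> b = y \<and> has_riem_length M \<gamma> a b L"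
  using assms
proof induction
  case (empty x)
  show ?case
  proof (intro exI conjI)
    show "has_riem_length M (\<lambda>_. x) 0 0 0"
      unfolding has_riem_length_def by (rule exI[of _ 0], rule exI[of _ "\<lambda>_. 0"]) simp
  qed simp_all
next
  case (step x \<sigma> u L c v)
  then obtain \<gamma> a b where \<gamma>: "\<gamma> a = x" "\<gamma> b = \<sigma> u" "has_riem_length M \<gamma> a b L" by blast
  from \<gamma>(3) obtain m t e where *: "t 0 = a" "t m = b"
    "\<And>i. i < m \<Longrightarrow> t i < t (Suc i) \<and> e i \<in> atlas M \<and> C1_in_chart M (e i) {t i..t (Suc i)} \<gamma>"
    "L = (\<Sum>i<m. integral {t i..t (Suc i)} (speed_in_chart M (e i) {t i..t (Suc i)} \<gamma>))"
    by (auto simp: has_riem_length_def)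
  have tb: "t i \<le> b" if "i \<le> m" for i
    using that
  proof (induction i rule: inc_induct)
    case (step i)
    then show ?case using *(3)[of i] by simp
  qed (simp add: *)
  define b' where "b' = b + (v - u)"
  have b': "b < b'" using step by (simp add: b'_def)
  define \<gamma>' where "\<gamma>' s = (if s \<le> b then \<gamma> s else \<sigma> (s + (u - b)))" for s
  define t' where "t' = t(Suc m := b')"
  define e' where "e' = e(m := c)"
  have old: "C1_in_chart M (e i) {t i..t (Suc i)} \<gamma>'"
    "integral {t i..t (Suc i)} (speed_in_chart M (e i) {t i..t (Suc i)} \<gamma>') =
     integral {t i..t (Suc i)} (speed_in_chart M (e i) {t i..t (Suc i)} \<gamma>)" if "i < m" for i
  proof -
    have "\<gamma>' s = \<gamma> (1 * s + 0)" if "s \<in> {t i..t (Suc i)}" for s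
      using that tb[of "Suc i"] \<open>i < m\<close> by (simp add: \<gamma>'_def)
    from C1_curve_reparametrize[of "t i" "t (Suc i)" "t i" "t (Suc i)" M "e i" \<gamma> 1 0 \<gamma>',
        OF _ _ _ _ _ this] *(3)[OF that]
    show "C1_in_chart M (e i) {t i..t (Suc i)} \<gamma>'"
      "integral {t i..t (Suc i)} (speed_in_chart M (e i) {t i..t (Suc i)} \<gamma>') =
       integral {t i..t (Suc i)} (speed_in_chart M (e i) {t i..t (Suc i)} \<gamma>)" by simp_all
  qed
  have im: "(\<lambda>s. 1 * s + (u - b)) ` {b..b'} = {u..v}"
    unfolding b'_def mult_1 image_add_atLeastAtMost' by simp
  have agree: "\<gamma>' s = \<sigma> (1 * s + (u - b))" if "s \<in> {b..b'}" for s
    using that \<gamma>(2) by (cases "s = b") (auto simp: \<gamma>'_def)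
  have new: "C1_in_chart M c {b..b'} \<gamma>'"
    "integral {b..b'} (speed_in_chart M c {b..b'} \<gamma>') =
     integral {u..v} (speed_in_chart M c {u..v} \<sigma>)"
    using C1_curve_reparametrize[OF step(3) b' step(4) _ im agree] by simp_all
  have "has_riem_length M \<gamma>' a b' (L + integral {u..v} (speed_in_chart M c {u..v} \<sigma>))"
    unfolding has_riem_length_def
  proof (intro exI conjI allI impI)
    show "t' 0 = a" "t' (Suc m) = b'" using * by (auto simp: t'_def)
    fix i assume i: "i < Suc m"
    consider "i < m" | "i = m" using i by linarith
    then have "t' i < t' (Suc i) \<and> e' i \<in> atlas M \<and> C1_in_chart M (e' i) {t' i..t' (Suc i)} \<gamma>'"
    proof cases
      case 1
      then show ?thesis using *(3)[of i] old(1)[of i] by (simp add: t'_def e'_def)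
    next
      case 2
      then show ?thesis using *(2) b' new(1) step(2) by (simp add: t'_def e'_def)
    qed
    then show "t' i < t' (Suc i)" "e' i \<in> atlas M" "C1_in_chart M (e' i) {t' i..t' (Suc i)} \<gamma>'"
      by blast+
  next
    show "L + integral {u..v} (speed_in_chart M c {u..v} \<sigma>) =
      (\<Sum>i<Suc m. integral {t' i..t' (Suc i)} (speed_in_chart M (e' i) {t' i..t' (Suc i)} \<gamma>'))"
      using *(2,4) new(2) old(2) by (simp add: t'_def e'_def)
  qed
  moreover have "\<gamma>' a = x" using \<gamma>(1) tb[of 0] *(1) by (simp add: \<gamma>'_def)
  moreover have "\<gamma>' b' = \<sigma> v" using b' by (simp add: \<gamma>'_def b'_def)
  ultimately show ?case by blast
qed

lemma riem_dist_eq_Inf_chain: "riem_dist M x y = Inf {L. curve_chain M x y L}"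
proof -
  have "{L. \<exists>\<gamma> a b. \<gamma> a = x \<and> \<gamma> b = y \<and> has_riem_length M \<gamma> a b L} = {L. curve_chain M x y L}"
  proof (intro set_eqI iffI; unfold mem_Collect_eq)
    show "curve_chain M x y L" if "\<exists>\<gamma> a b. \<gamma> a = x \<and> \<gamma> b = y \<and> has_riem_length M \<gamma> a b L" for L
      using that by (elim exE conjE) (auto dest: curve_chain_if_has_riem_length)
  qed (rule has_riem_length_if_curve_chain)
  then show ?thesis by (simp add: riem_dist_def)
qed

lemma curve_chain_trans:
  assumes "curve_chain M y z L'" "curve_chain M x y L"
  shows "curve_chain M x z (L + L')"
  using assms
proof (induction arbitrary: x)
  case (step y \<gamma> u L' c v)
  then show ?case using curve_chain.step[of M x \<gamma> u "L + L'" c v] by (simp add: add.assoc)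
qed simp

lemma curve_chain_sym: "curve_chain M x y L \<Longrightarrow> curve_chain M y x L"
proof (induction rule: curve_chain.induct)
  case (step x \<gamma> u L c v)
  have im: "(\<lambda>t. - 1 * t + 0) ` {-v..-u} = {u..v}" by simp
  have "- v < - u" "\<And>t. \<gamma> (- t) = \<gamma> (- 1 * t + 0)" using step(3) by simp_all
  note rev = C1_curve_reparametrize[OF step(3) this(1) step(4) _ im this(2)]
  have "curve_chain M (\<gamma> v) (\<gamma> u) (integral {u..v} (speed_in_chart M c {u..v} \<gamma>))"
    using curve_chain.step[of M "\<gamma> v" "\<lambda>t. \<gamma> (- t)" "- v" 0 c "- u"] curve_chain.empty[of M "\<gamma> v"]
      rev step(2,3) by simp
  from curve_chain_trans[OF step.IH this] show ?case by (simp add: add.commute)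
qed (rule curve_chain.empty)

lemma curve_chain_nonneg:
  assumes M: "riemannian_metric M"
  shows "curve_chain M x y L \<Longrightarrow> 0 \<le> L"
proof (induction rule: curve_chain.induct)
  case (step x \<gamma> u L c v)
  let ?f = "speed_in_chart M c {u..v} \<gamma>"
  have f: "0 \<le> ?f t" if "t \<in> {u..v}" for t
  proof -
    define w where "w i = vector_derivative (\<lambda>s. snd c (\<gamma> s) i) (at t within {u..v})" for i
    have "\<gamma> t \<in> fst c" using step(4) that unfolding C1_in_chart_def by blast
    then have "snd c (\<gamma> t) \<in> snd c ` fst c" by (rule imageI)
    then have "(\<exists>i<mandim M. w i \<noteq> 0) \<longrightarrow>
        (\<Sum>i<mandim M. \<Sum>j<mandim M. gcoef M c (snd c (\<gamma> t)) i j * w i * w j) > 0"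
      using M step(2) unfolding riemannian_metric_def by blast
    moreover have "(\<Sum>i<mandim M. \<Sum>j<mandim M. gcoef M c (snd c (\<gamma> t)) i j * w i * w j) = 0"
      if "\<not> (\<exists>i<mandim M. w i \<noteq> 0)"
      using that by (auto intro!: sum.neutral)
    ultimately have "0 \<le> (\<Sum>i<mandim M. \<Sum>j<mandim M. gcoef M c (snd c (\<gamma> t)) i j * w i * w j)"
      by (cases "\<exists>i<mandim M. w i \<noteq> 0") auto
    then show ?thesis unfolding speed_in_chart_def w_def by (rule real_sqrt_ge_zero)
  qed
  have "0 \<le> integral {u..v} ?f"
    by (cases "?f integrable_on {u..v}")
      (use f in \<open>auto intro: integral_nonneg simp: not_integrable_integral\<close>)
  then show ?case using step by simp
qed simp

text \<open>
The image of a chart contains a box around the coordinates of \<open>y\<close>. Boxes are convex, so each point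
of the box can be joined to \<open>y\<close> by a curve that is a straight segment in coordinates.
\<close>

lemma curve_chain_nearby:
  assumes M: "smooth_manifold M" and y: "y \<in> points M"
  shows "\<exists>V. openin (mantop M) V \<and> y \<in> V \<and> (\<forall>z\<in>V. \<exists>L. curve_chain M y z L)"
proof -
  define n where "n = mandim M"
  obtain c where c: "c \<in> atlas M" "y \<in> fst c"
    using M y unfolding smooth_manifold_def by blast
  have hom: "openin (mantop M) (fst c)" "openin (Euclidean_space n) (snd c ` fst c)"
    "homeomorphic_map (subtopology (mantop M) (fst c))
       (subtopology (Euclidean_space n) (snd c ` fst c)) (snd c)"
    using M c(1) unfolding smooth_manifold_def n_def by blast+
  have sub: "fst c \<subseteq> points M" using hom(1) openin_subset by blast
  then have inj: "inj_on (snd c) (fst c)"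
    using homeomorphic_imp_injective_map[OF hom(3)] by (simp add: Int_absorb1)
  have im0: "z i = 0" if "z \<in> snd c ` fst c" "i \<ge> n" for z i
    using openin_subset[OF hom(2)] that by (auto simp: topspace_Euclidean_space)
  define q where "q = snd c y"
  have q: "q \<in> snd c ` fst c" using c by (simp add: q_def)
  obtain W where W: "openin (powertop_real UNIV) W" "snd c ` fst c = W \<inter> {x. \<forall>i\<ge>n. x i = 0}"
    using hom(2) unfolding Euclidean_space_def openin_subtopology by blast
  obtain U where U: "\<And>i. openin euclideanreal (U i)" "q \<in> Pi\<^sub>E UNIV U" "Pi\<^sub>E UNIV U \<subseteq> W"
  proof -
    have "q \<in> W" using q W(2) by blast
    from W(1)[unfolded openin_product_topology_alt, rule_format, OF this]
    show thesis using that by simp blast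
  qed
  have "\<exists>e>0. ball (q i) e \<subseteq> U i" for i
  proof -
    have "open (U i)" "q i \<in> U i" using U(1)[of i] U(2) by (auto simp: PiE_iff)
    then show ?thesis by (simp add: open_contains_ball)
  qed
  then obtain e where e: "\<And>i. e i > 0" "\<And>i. ball (q i) (e i) \<subseteq> U i" by metis
  define N where "N = {p \<in> topspace (Euclidean_space n). \<forall>i<n. \<bar>p i - q i\<bar> < e i}"
  have NW: "p \<in> snd c ` fst c" if "p \<in> N" for p
  proof -
    have "p i \<in> U i" for i
    proof -
      have "\<bar>p i - q i\<bar> < e i"
        using that e(1)[of i] im0[OF q, of i]
        by (cases "i < n") (auto simp: N_def topspace_Euclidean_space)
      then show ?thesis using e(2)[of i] by (auto simp: dist_real_def)
    qed
    then show ?thesis using that U(3) W(2) by (auto simp: N_def topspace_Euclidean_space)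
  qed
  have "openin (Euclidean_space n) N"
  proof -
    have coord: "continuous_map (Euclidean_space n) euclideanreal (\<lambda>p. p i)" for i
      unfolding Euclidean_space_def
      by (intro continuous_map_from_subtopology continuous_map_product_projection) simp
    have "openin (Euclidean_space n) {p \<in> topspace (Euclidean_space n). p i \<in> ball (q i) (e i)}" for i
      by (rule openin_continuous_map_preimage[OF coord]) simp
    then have "openin (Euclidean_space n) (topspace (Euclidean_space n) \<inter>
        (\<Inter>i\<in>{..<n}. {p \<in> topspace (Euclidean_space n). p i \<in> ball (q i) (e i)}))"
      by (intro openin_Int_Inter) auto
    moreover have "N = topspace (Euclidean_space n) \<inter>
        (\<Inter>i\<in>{..<n}. {p \<in> topspace (Euclidean_space n). p i \<in> ball (q i) (e i)})"
      by (auto simp: N_def dist_real_def abs_minus_commute[of "q _"])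
    ultimately show ?thesis by simp
  qed
  moreover have "N \<subseteq> snd c ` fst c" using NW by blast
  ultimately have Nsub: "openin (subtopology (Euclidean_space n) (snd c ` fst c)) N"
    by (simp add: openin_open_subtopology hom(2))
  define V where "V = {z \<in> fst c. snd c z \<in> N}"
  have "openin (subtopology (mantop M) (fst c))
      {z \<in> topspace (subtopology (mantop M) (fst c)). snd c z \<in> N}"
    by (rule openin_continuous_map_preimage[OF homeomorphic_imp_continuous_map[OF hom(3)] Nsub])
  then have "openin (mantop M) V"
    using hom(1) sub unfolding V_def by (simp add: Int_absorb1 openin_open_subtopology)
  moreover have "y \<in> V"
    using c e(1) openin_subset[OF hom(2)] q by (auto simp: V_def N_def q_def)
  moreover have "\<exists>L. curve_chain M y z L" if z: "z \<in> V" for z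
  proof -
    define p where "p = snd c z"
    define w where "w s = (\<lambda>i. (1 - s) * q i + s * p i)" for s :: real
    define \<gamma> where "\<gamma> s = inv_into (fst c) (snd c) (w s)" for s
    have wN: "w s \<in> N" if "s \<in> {0..1}" for s
    proof -
      have pN: "p \<in> N" using z by (simp add: V_def p_def)
      have "\<bar>w s i - q i\<bar> < e i" if "i < n" for i
      proof -
        have "w s i - q i = s * (p i - q i)" by (simp add: w_def algebra_simps)
        then have "\<bar>w s i - q i\<bar> = s * \<bar>p i - q i\<bar>"
          using \<open>s \<in> {0..1}\<close> by (simp add: abs_mult)
        also have "\<dots> \<le> 1 * \<bar>p i - q i\<bar>"
          using \<open>s \<in> {0..1}\<close> by (intro mult_right_mono) auto
        finally have "\<bar>w s i - q i\<bar> \<le> \<bar>p i - q i\<bar>" by simp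
        then show ?thesis using pN that by (auto simp: N_def)
      qed
      moreover have "w s \<in> topspace (Euclidean_space n)"
        using pN im0[OF q] by (simp add: w_def N_def topspace_Euclidean_space)
      ultimately show ?thesis by (simp add: N_def)
    qed
    have \<gamma>c: "\<gamma> s \<in> fst c" "snd c (\<gamma> s) = w s" if "s \<in> {0..1}" for s
      unfolding \<gamma>_def using NW[OF wN[OF that]] by (auto intro: inv_into_into f_inv_into_f)
    have "w 0 = q" "w 1 = p" by (auto simp: w_def)
    then have ends: "\<gamma> 0 = y" "\<gamma> 1 = z"
      using c z inj by (auto simp: \<gamma>_def q_def p_def V_def)
    have "C1_in_chart M c {0..1} \<gamma>"
      unfolding C1_in_chart_def
    proof (intro conjI allI impI)
      show "\<gamma> ` {0..1} \<subseteq> fst c" using \<gamma>c by auto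
      fix i
      have "((\<lambda>s. snd c (\<gamma> s) i) has_real_derivative p i - q i) (at t within {0..1})"
        if "t \<in> {0..1}" for t
      proof (rule has_field_derivative_transform_within[where d = 1])
        show "((\<lambda>s. w s i) has_real_derivative p i - q i) (at t within {0..1})"
          unfolding w_def by (auto intro!: derivative_eq_intros)
      qed (use that \<gamma>c in auto)
      then show "\<exists>v. continuous_on {0..1} v \<and>
          (\<forall>t\<in>{0..1}. ((\<lambda>s. snd c (\<gamma> s) i) has_real_derivative v t) (at t within {0..1}))"
        by (intro exI[of _ "\<lambda>_. p i - q i"]) auto
    qed
    then show ?thesis
      using curve_chain.step[of M y \<gamma> 0 0 c 1] curve_chain.empty[of M y] c(1) ends
      by (intro exI) simp
  qed
  ultimately show ?thesis by blast
qed

text \<open>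
By \<open>curve_chain_nearby\<close>, the set of points that can be reached from \<open>x\<close> and its complement are both open.
\<close>

lemma curve_chain_exists:
  assumes M: "open_riemannian_manifold M" and xy: "x \<in> points M" "y \<in> points M"
  shows "\<exists>L. curve_chain M x y L"
proof -
  have sm: "smooth_manifold M" and conn: "connected_space (mantop M)"
    using M by (auto simp: open_riemannian_manifold_def)
  define R where "R = {z \<in> points M. \<exists>L. curve_chain M x z L}"
  have "openin (mantop M) R"
  proof (subst openin_subopen, intro ballI)
    fix z assume "z \<in> R"
    then obtain V where V: "openin (mantop M) V" "z \<in> V" "\<forall>a\<in>V. \<exists>L. curve_chain M z a L"
      using curve_chain_nearby[OF sm, of z] by (auto simp: R_def)
    moreover have "V \<subseteq> R"
    proof
      fix a assume "a \<in> V"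
      then obtain L L' where "curve_chain M z a L'" "curve_chain M x z L"
        using V(3) \<open>z \<in> R\<close> by (auto simp: R_def)
      from curve_chain_trans[OF this] show "a \<in> R"
        using openin_subset[OF V(1)] \<open>a \<in> V\<close> by (auto simp: R_def)
    qed
    ultimately show "\<exists>V. openin (mantop M) V \<and> z \<in> V \<and> V \<subseteq> R" by blast
  qed
  moreover have "openin (mantop M) (points M - R)"
  proof (subst openin_subopen, intro ballI)
    fix z assume z: "z \<in> points M - R"
    then obtain V where V: "openin (mantop M) V" "z \<in> V" "\<forall>a\<in>V. \<exists>L. curve_chain M z a L"
      using curve_chain_nearby[OF sm, of z] by auto
    moreover have "V \<subseteq> points M - R"
    proof
      fix a assume "a \<in> V"
      then obtain L' where "curve_chain M z a L'" using V(3) by auto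
      then have L': "curve_chain M a z L'" by (rule curve_chain_sym)
      have "a \<notin> R"
      proof
        assume "a \<in> R"
        then obtain L where "curve_chain M x a L" by (auto simp: R_def)
        from curve_chain_trans[OF L' this] show False using z by (auto simp: R_def)
      qed
      then show "a \<in> points M - R" using openin_subset[OF V(1)] \<open>a \<in> V\<close> by blast
    qed
    ultimately show "\<exists>V. openin (mantop M) V \<and> z \<in> V \<and> V \<subseteq> points M - R" by blast
  qed
  moreover have "R \<subseteq> points M" "x \<in> R" using xy curve_chain.empty[of M x] by (auto simp: R_def)
  ultimately have "R = points M"
    using conn unfolding connected_space_clopen_in closedin_def by (metis empty_iff)
  then show ?thesis using xy by (auto simp: R_def)
qed

text \<open>
The existence of chains is needed for the triangle inequality: the infimum of the empty set of reals
is an unspecified number.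
\<close>

lemma pseudometric_riem_dist:
  assumes M: "open_riemannian_manifold M"
  shows "pseudometric_on (points M) (riem_dist M)"
proof
  have "riemannian_metric M" using M by (simp add: open_riemannian_manifold_def)
  then have bdd: "bdd_below {L. curve_chain M x y L}" for x y
    using curve_chain_nonneg by (auto intro!: bdd_belowI[of _ 0])
  have lower: "riem_dist M x y \<le> L" if "curve_chain M x y L" for x y L
    unfolding riem_dist_eq_Inf_chain using that by (auto intro: cInf_lower bdd)
  have greatest: "m \<le> riem_dist M x y"
    if "x \<in> points M" "y \<in> points M" "\<And>L. curve_chain M x y L \<Longrightarrow> m \<le> L" for x y m
    unfolding riem_dist_eq_Inf_chain
    using curve_chain_exists[OF M that(1,2)] that(3) by (auto intro: cInf_greatest)
  show "riem_dist M x x = 0" if "x \<in> points M" for x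
  proof (rule antisym)
    show "riem_dist M x x \<le> 0" by (rule lower[OF curve_chain.empty])
    show "0 \<le> riem_dist M x x"
      by (rule greatest[OF that that]) (rule curve_chain_nonneg[OF \<open>riemannian_metric M\<close>])
  qed
  show "riem_dist M x y = riem_dist M y x" if "x \<in> points M" "y \<in> points M" for x y
  proof -
    have "curve_chain M x y = curve_chain M y x"
      by (intro ext iffI) (rule curve_chain_sym, assumption)+
    then show ?thesis by (simp add: riem_dist_eq_Inf_chain)
  qed
  show "riem_dist M x z \<le> riem_dist M x y + riem_dist M y z"
    if xyz: "x \<in> points M" "y \<in> points M" "z \<in> points M" for x y z
  proof -
    have "riem_dist M x z - riem_dist M x y \<le> L'" if L': "curve_chain M y z L'" for L'
    proof -
      have "riem_dist M x z - L' \<le> riem_dist M x y"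
      proof (rule greatest[OF xyz(1,2)])
        fix L assume "curve_chain M x y L"
        from lower[OF curve_chain_trans[OF L' this]] show "riem_dist M x z - L' \<le> L" by simp
      qed
      then show ?thesis by simp
    qed
    then have "riem_dist M x z - riem_dist M x y \<le> riem_dist M y z"
      by (rule greatest[OF xyz(2,3)])
    then show ?thesis by simp
  qed
qed

section \<open>Hausdorff and Gromov-Hausdorff limits\<close>

lemma hausdorff_dist_less:
  assumes "hausdorff_dist d A B < ennreal e"
  shows "a \<in> A \<Longrightarrow> \<exists>b\<in>B. d a b < e" and "b \<in> B \<Longrightarrow> \<exists>a\<in>A. d a b < e"
proof -
  show "\<exists>b\<in>B. d a b < e" if "a \<in> A"
  proof -
    have "(INF b\<in>B. ennreal (d a b)) \<le> hausdorff_dist d A B"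
      unfolding hausdorff_dist_def by (rule max.coboundedI1) (rule SUP_upper[OF that])
    then have "(INF b\<in>B. ennreal (d a b)) < ennreal e" using assms by (rule order.strict_trans1)
    then show ?thesis unfolding INF_less_iff by (meson ennreal_leI not_le)
  qed
  show "\<exists>a\<in>A. d a b < e" if "b \<in> B"
  proof -
    have "(INF a\<in>A. ennreal (d a b)) \<le> hausdorff_dist d A B"
      unfolding hausdorff_dist_def by (rule max.coboundedI2) (rule SUP_upper[OF that])
    then have "(INF a\<in>A. ennreal (d a b)) < ennreal e" using assms by (rule order.strict_trans1)
    then show ?thesis unfolding INF_less_iff by (meson ennreal_leI not_le)
  qed
qed

lemma hausdorff_conv_eventually:
  assumes "hausdorff_conv Z A B" and "e > 0"
  shows "eventually (\<lambda>j. hausdorff_dist (mdist Z) (A j) B < ennreal e) sequentially"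
  using order_tendstoD(2)[of _ 0 sequentially "ennreal e"] assms by (simp add: hausdorff_conv_def)

text \<open>
A point of \<open>W\<close> is close to a point of \<open>A j\<close> for large \<open>j\<close>, which is close to a point of \<open>W'\<close>.
\<close>

lemma hausdorff_limit_subset_closure:
  assumes "hausdorff_conv Z A W" "hausdorff_conv Z A W'"
    and "\<And>j. A j \<subseteq> mspace Z" "W \<subseteq> mspace Z" "W' \<subseteq> mspace Z"
  shows "W \<subseteq> mtopology_of Z closure_of W'"
proof
  interpret Metric_space "mspace Z" "mdist Z" by simp
  fix w assume w: "w \<in> W"
  show "w \<in> mtopology_of Z closure_of W'"
    unfolding in_closure_iff_near
  proof (intro conjI allI impI)
    fix e :: real assume "e > 0"
    then have "eventually (\<lambda>j. hausdorff_dist (mdist Z) (A j) W < ennreal (e/2) \<and>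
        hausdorff_dist (mdist Z) (A j) W' < ennreal (e/2)) sequentially"
      by (intro eventually_conj hausdorff_conv_eventually assms) simp_all
    then obtain j where j: "hausdorff_dist (mdist Z) (A j) W < ennreal (e/2)"
      "hausdorff_dist (mdist Z) (A j) W' < ennreal (e/2)"
      using eventually_happens'[OF sequentially_bot] by blast
    obtain a where a: "a \<in> A j" "mdist Z a w < e/2" using hausdorff_dist_less(2)[OF j(1) w] by blast
    obtain y where y: "y \<in> W'" "mdist Z a y < e/2"
      using hausdorff_dist_less(1)[OF j(2) a(1)] by blast
    have "w \<in> mspace Z" "a \<in> mspace Z" "y \<in> mspace Z" using w a y assms(3,4,5) by auto
    then have "mdist Z w y < e" using triangle[of w a y] a(2) y(2) commute[of w a] by linarith
    then show "\<exists>y\<in>W'. y \<in> mspace Z \<and> mdist Z w y < e" using y \<open>y \<in> mspace Z\<close> by blast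
  qed (use w assms in auto)
qed

lemma hausdorff_limit_unique:
  assumes "hausdorff_conv Z A W" "hausdorff_conv Z A W'" and A: "\<And>j. A j \<subseteq> mspace Z"
    and W: "compactin (mtopology_of Z) W" "compactin (mtopology_of Z) W'"
  shows "W = W'"
proof -
  interpret Metric_space "mspace Z" "mdist Z" by simp
  have "Hausdorff_space (mtopology_of Z)" by (simp add: mtopology_of_def Hausdorff_space_mtopology)
  then have "mtopology_of Z closure_of W = W" "mtopology_of Z closure_of W' = W'"
    using W compactin_imp_closedin closure_of_closedin by blast+
  moreover have "W \<subseteq> mspace Z" "W' \<subseteq> mspace Z"
    using W[THEN compactin_subset_topspace] by simp_all
  ultimately show ?thesis
    using hausdorff_limit_subset_closure[OF assms(1,2) A] hausdorff_limit_subset_closure[OF assms(2,1) A]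
    by blast
qed

text \<open>
Both spaces are isometric to subsets of a common space that are Hausdorff close, so points can be moved
from one to the other by less than \<open>e\<close>.
\<close>

lemma gh_dist_less_almost_embeds:
  assumes "gh_dist A B < ennreal e"
  shows "almost_embeds (mspace A) (mdist A) (mspace B) (mdist B) (2 * e)"
    and "almost_embeds (mspace B) (mdist B) (mspace A) (mdist A) (2 * e)"
proof -
  obtain Z :: "real metric" and f g where f: "isometric_embedding A Z f"
    and g: "isometric_embedding B Z g"
    and fg: "hausdorff_dist (mdist Z) (f ` mspace A) (g ` mspace B) < ennreal e"
    using assms by (auto simp: gh_dist_def Inf_less_iff)
  have sub: "f ` mspace A \<subseteq> mspace Z" "g ` mspace B \<subseteq> mspace Z"
    using f g by (auto simp: isometric_embedding_def)
  have iso: "almost_embeds (mspace C) (mdist C) (h ` mspace C) (mdist Z) 0"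
    "almost_embeds (h ` mspace C) (mdist Z) (mspace C) (mdist C) 0"
    if "isometric_embedding C Z h" for C :: "'c metric" and h
  proof -
    have hd: "mdist Z (h x) (h y) = mdist C x y" if "x \<in> mspace C" "y \<in> mspace C" for x y
      using \<open>isometric_embedding C Z h\<close> that by (auto simp: isometric_embedding_def)
    show "almost_embeds (mspace C) (mdist C) (h ` mspace C) (mdist Z) 0"
      by (rule almost_embeds_isometric[of _ h]) (auto simp: hd)
    show "almost_embeds (h ` mspace C) (mdist Z) (mspace C) (mdist C) 0"
      by (rule almost_embeds_isometric[of _ "inv_into (mspace C) h"])
        (simp_all add: inv_into_into f_inv_into_f flip: hd)
  qed
  have "almost_embeds (f ` mspace A) (mdist Z) (g ` mspace B) (mdist Z) (2 * e)"
    by (rule almost_embeds_near[OF sub]) (rule hausdorff_dist_less(1)[OF fg])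
  from almost_embeds_trans[OF almost_embeds_trans[OF iso(1)[OF f] this] iso(2)[OF g]]
  show "almost_embeds (mspace A) (mdist A) (mspace B) (mdist B) (2 * e)" by simp
  have "almost_embeds (g ` mspace B) (mdist Z) (f ` mspace A) (mdist Z) (2 * e)"
    by (rule almost_embeds_near[OF sub(2,1)])
      (use hausdorff_dist_less(2)[OF fg] in \<open>simp add: mdist_commute\<close>)
  from almost_embeds_trans[OF almost_embeds_trans[OF iso(1)[OF g] this] iso(2)[OF f]]
  show "almost_embeds (mspace B) (mdist B) (mspace A) (mdist A) (2 * e)" by simp
qed

section \<open>Inner regions\<close>

lemma inner_region_subset: "inner_region M \<delta> \<subseteq> points M"
  by (auto simp: inner_region_def)

lemma inner_region_antimono: "\<delta>' \<le> \<delta> \<Longrightarrow> inner_region M \<delta> \<subseteq> inner_region M \<delta>'"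
  by (auto simp: inner_region_def)

text \<open>
Inside the completion of the whole manifold, a point of the completed inner region is the class of a
Cauchy sequence of the inner region, and this sequence also lies in the larger inner region.
\<close>

lemma inner_in_completion_antimono:
  assumes M: "open_riemannian_manifold M" and le: "\<delta>' \<le> \<delta>"
  shows "inner_in_completion M \<delta> \<subseteq> inner_in_completion M \<delta>'"
proof -
  have "cauchy_seqs (inner_region M \<delta>) (riem_dist M) \<subseteq> cauchy_seqs (inner_region M \<delta>') (riem_dist M)"
    by (intro cauchy_seqs_mono inner_region_antimono le)
  then show ?thesis
    unfolding inner_in_completion_def inner_completion_def
      image_completion_incl[OF pseudometric_riem_dist[OF M] inner_region_subset]
    by (rule image_mono)
qed

lemma inner_completion_isometric:
  assumes "open_riemannian_manifold M"
  shows "isometric_embedding (inner_completion M \<delta>) (mcompletion M)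
    (completion_incl (points M) (riem_dist M))"
  unfolding inner_completion_def mcompletion_def
  by (rule completion_incl_isometric[OF pseudometric_riem_dist[OF assms] inner_region_subset])

lemma
  assumes M: "open_riemannian_manifold M" and f: "isometric_embedding (mcompletion M) Z f"
  shows inner_image_subset: "f ` inner_in_completion M \<delta> \<subseteq> mspace Z"
    and inner_completion_to_image:
      "almost_embeds (mspace (inner_completion M \<delta>)) (mdist (inner_completion M \<delta>))
        (f ` inner_in_completion M \<delta>) (mdist Z) 0"
    and image_to_inner_completion:
      "almost_embeds (f ` inner_in_completion M \<delta>) (mdist Z)
        (mspace (inner_completion M \<delta>)) (mdist (inner_completion M \<delta>)) 0"
proof -
  define \<iota> where "\<iota> = completion_incl (points M) (riem_dist M)"
  let ?C = "mspace (inner_completion M \<delta>)"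
  have \<iota>: "\<iota> x \<in> mspace (mcompletion M)"
    "mdist (mcompletion M) (\<iota> x) (\<iota> y) = mdist (inner_completion M \<delta>) x y"
    if "x \<in> ?C" "y \<in> ?C" for x y
    using inner_completion_isometric[OF M, of \<delta>] that by (auto simp: isometric_embedding_def \<iota>_def)
  have d: "mdist Z (f (\<iota> x)) (f (\<iota> y)) = mdist (inner_completion M \<delta>) x y" "f (\<iota> x) \<in> mspace Z"
    if "x \<in> ?C" "y \<in> ?C" for x y
    using f \<iota>[OF that] \<iota>(1)[OF that(2) that(2)] by (auto simp: isometric_embedding_def)
  have im: "f ` inner_in_completion M \<delta> = (\<lambda>x. f (\<iota> x)) ` ?C"
    by (simp add: inner_in_completion_def \<iota>_def image_image)
  show "f ` inner_in_completion M \<delta> \<subseteq> mspace Z" unfolding im using d(2) by blast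
  show "almost_embeds ?C (mdist (inner_completion M \<delta>)) (f ` inner_in_completion M \<delta>) (mdist Z) 0"
    unfolding im by (rule almost_embeds_isometric[of _ "\<lambda>x. f (\<iota> x)"]) (auto simp: d)
  show "almost_embeds (f ` inner_in_completion M \<delta>) (mdist Z) ?C (mdist (inner_completion M \<delta>)) 0"
    unfolding im
    by (rule almost_embeds_isometric[of _ "inv_into ?C (\<lambda>x. f (\<iota> x))"])
      (simp_all add: inv_into_into f_inv_into_f[of _ "\<lambda>x. f (\<iota> x)"] flip: d(1))
qed

section \<open>The glued space as a union of the pieces\<close>

text \<open>
The canonical map of the points with index at most \<open>i\<close> into the piece \<open>Y (\<delta> i)\<close>.
\<close>

definition glue_into :: "(nat \<Rightarrow> 'y \<Rightarrow> 'y) \<Rightarrow> nat \<Rightarrow> nat \<times> 'y \<Rightarrow> 'y" where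
  "glue_into \<psi> i = (\<lambda>(a, x). glue_map \<psi> a (i - a) x)"

lemma isometric_embedding_comp:
  "isometric_embedding A B h \<Longrightarrow> isometric_embedding B C k \<Longrightarrow> isometric_embedding A C (k \<circ> h)"
  by (simp add: isometric_embedding_def Pi_iff)

lemma glue_map_add: "glue_map \<psi> b (m + n) x = glue_map \<psi> (b + m) n (glue_map \<psi> b m x)"
  by (induction n) (auto simp: add.assoc)

context
  fixes \<delta> :: "nat \<Rightarrow> real" and Y :: "real \<Rightarrow> 'y metric" and \<psi> :: "nat \<Rightarrow> 'y \<Rightarrow> 'y"
  assumes emb: "\<And>i. isometric_embedding (Y (\<delta> i)) (Y (\<delta> (Suc i))) (\<psi> i)"
begin

lemma glue_map_isometric: "isometric_embedding (Y (\<delta> b)) (Y (\<delta> (b + n))) (glue_map \<psi> b n)"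
proof (induction n)
  case (Suc n)
  from isometric_embedding_comp[OF this emb[of "b + n"]] show ?case by (simp add: comp_def)
qed (simp add: isometric_embedding_def)

text \<open>
The distance of two glued points is taken in the later of their two pieces; carrying both points on
to the piece \<open>Y (\<delta> i)\<close> by isometric embeddings does not change it.
\<close>

lemma glue_into_isometric:
  assumes "p \<in> glued_points \<delta> Y \<psi>" "q \<in> glued_points \<delta> Y \<psi>" "fst p \<le> i" "fst q \<le> i"
  shows "glue_into \<psi> i p \<in> mspace (Y (\<delta> i))"
    and "mdist (Y (\<delta> i)) (glue_into \<psi> i p) (glue_into \<psi> i q) = glued_dist \<delta> Y \<psi> p q"
proof -
  obtain a x b y where [simp]: "p = (a, x)" "q = (b, y)" by (cases p, cases q)
  have x: "x \<in> mspace (Y (\<delta> a))" and y: "y \<in> mspace (Y (\<delta> b))"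
    using assms by (auto simp: glued_points_def)
  have map: "glue_map \<psi> c (n - c) z \<in> mspace (Y (\<delta> n))"
    "mdist (Y (\<delta> n)) (glue_map \<psi> c (n - c) z) (glue_map \<psi> c (n - c) z') = mdist (Y (\<delta> c)) z z'"
    if "c \<le> n" "z \<in> mspace (Y (\<delta> c))" "z' \<in> mspace (Y (\<delta> c))" for c n z z'
    using glue_map_isometric[of c "n - c"] that by (auto simp: isometric_embedding_def)
  have comp: "glue_map \<psi> c (i - c) z = glue_map \<psi> n (i - n) (glue_map \<psi> c (n - c) z)"
    if "c \<le> n" "n \<le> i" for c n z
    using glue_map_add[of \<psi> c "n - c" "i - n" z] that by simp
  show "glue_into \<psi> i p \<in> mspace (Y (\<delta> i))"
    using map(1)[of a i x] x assms by (simp add: glue_into_def)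
  show "mdist (Y (\<delta> i)) (glue_into \<psi> i p) (glue_into \<psi> i q) = glued_dist \<delta> Y \<psi> p q"
  proof (cases "b \<le> a")
    case True
    have "glue_into \<psi> i q = glue_map \<psi> a (i - a) (glue_map \<psi> b (a - b) y)"
      using comp[OF True] assms by (simp add: glue_into_def)
    moreover have "glue_into \<psi> i p = glue_map \<psi> a (i - a) x" by (simp add: glue_into_def)
    ultimately show ?thesis
      using map(2)[OF _ x map(1)[OF True y y], of i] True assms by (simp add: glued_dist_def)
  next
    case False
    then have "a \<le> b" by simp
    have "glue_into \<psi> i p = glue_map \<psi> b (i - b) (glue_map \<psi> a (b - a) x)"
      using comp[OF \<open>a \<le> b\<close>] assms by (simp add: glue_into_def)
    moreover have "glue_into \<psi> i q = glue_map \<psi> b (i - b) y" by (simp add: glue_into_def)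
    ultimately show ?thesis
      using map(2)[OF _ y map(1)[OF \<open>a \<le> b\<close> x x], of i] False assms
      by (simp add: glued_dist_def mdist_commute[of _ "glue_map \<psi> b (i - b) (glue_map \<psi> a (b - a) x)"])
  qed
qed

text \<open>
A point of \<open>Y (\<delta> (i + 1))\<close> either comes from \<open>Y (\<delta> i)\<close>, or is itself one of the glued points.
\<close>

lemma glue_into_onto:
  assumes "y \<in> mspace (Y (\<delta> i))"
  shows "\<exists>p\<in>glued_points \<delta> Y \<psi>. fst p \<le> i \<and> glue_into \<psi> i p = y"
  using assms
proof (induction i arbitrary: y)
  case 0
  then show ?case by (intro bexI[of _ "(0, y)"]) (auto simp: glue_into_def glued_points_def)
next
  case (Suc i)
  show ?case
  proof (cases "y \<in> \<psi> i ` mspace (Y (\<delta> i))")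
    case True
    then obtain z where "z \<in> mspace (Y (\<delta> i))" "y = \<psi> i z" by auto
    with Suc.IH[of z] obtain p
      where p: "p \<in> glued_points \<delta> Y \<psi>" "fst p \<le> i" "y = \<psi> i (glue_into \<psi> i p)" by auto
    then have "glue_into \<psi> (Suc i) p = y"
      by (cases p) (auto simp: glue_into_def Suc_diff_le)
    then show ?thesis using p by (intro bexI[of _ p]) auto
  next
    case False
    then show ?thesis using Suc.prems
      by (intro bexI[of _ "(Suc i, y)"]) (auto simp: glue_into_def glued_points_def)
  qed
qed

lemma finite_glued_points_embed:
  assumes "finite F" "F \<subseteq> glued_points \<delta> Y \<psi>"
  shows "\<exists>i. almost_embeds F (glued_dist \<delta> Y \<psi>) (mspace (Y (\<delta> i))) (mdist (Y (\<delta> i))) 0"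
proof -
  obtain i where "\<forall>n\<in>fst ` F. n \<le> i" 
    using finite_imageI[OF assms(1), of fst] unfolding finite_nat_set_iff_bounded_le by auto
  then have "almost_embeds F (glued_dist \<delta> Y \<psi>) (mspace (Y (\<delta> i))) (mdist (Y (\<delta> i))) 0"
    using assms(2) by (intro almost_embeds_isometric[of _ "glue_into \<psi> i"] glue_into_isometric) auto
  then show ?thesis by blast
qed

lemma piece_embeds_in_glued_points:
  "almost_embeds (mspace (Y (\<delta> i))) (mdist (Y (\<delta> i))) (glued_points \<delta> Y \<psi>) (glued_dist \<delta> Y \<psi>) 0"
proof -
  have "\<forall>y\<in>mspace (Y (\<delta> i)). \<exists>p. p \<in> glued_points \<delta> Y \<psi> \<and> fst p \<le> i \<and> glue_into \<psi> i p = y"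
    using glue_into_onto by blast
  from bchoice[OF this] obtain s where s: "\<And>y. y \<in> mspace (Y (\<delta> i)) \<Longrightarrow>
      s y \<in> glued_points \<delta> Y \<psi> \<and> fst (s y) \<le> i \<and> glue_into \<psi> i (s y) = y"
    by blast
  show ?thesis
  proof (rule almost_embeds_isometric[of _ s])
    show "s y \<in> glued_points \<delta> Y \<psi>" if "y \<in> mspace (Y (\<delta> i))" for y
      using s[OF that] by blast
    show "glued_dist \<delta> Y \<psi> (s y) (s z) = mdist (Y (\<delta> i)) y z"
      if "y \<in> mspace (Y (\<delta> i))" "z \<in> mspace (Y (\<delta> i))" for y z
      using glue_into_isometric(2)[of "s y" "s z" i] s[OF that(1)] s[OF that(2)] by simp
  qed
qed

end

section \<open>Inner unions and glued limits\<close>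

text \<open>
The definite description picks the Hausdorff limit, which is unique among compact sets.
\<close>

lemma inner_union_eq:
  assumes M: "\<And>j. open_riemannian_manifold (M j)" and Z: "common_embedding M X Z f g"
  shows "inner_union M X Z f g r = {x \<in> mspace X. \<exists>\<delta> W. \<delta> > 0 \<and> inner_limit M X Z f g r \<delta> W \<and> g x \<in> W}"
proof -
  have "(THE W. inner_limit M X Z f g r \<delta> W) = W" if W: "inner_limit M X Z f g r \<delta> W" for \<delta> W
  proof (rule the_equality[of "inner_limit M X Z f g r \<delta>", OF W])
    fix W' assume W': "inner_limit M X Z f g r \<delta> W'"
    have "f (r k) ` inner_in_completion (M (r k)) \<delta> \<subseteq> mspace Z" for k
      using Z by (intro inner_image_subset M) (auto simp: common_embedding_def)
    then show "W' = W"
      using W W' unfolding inner_limit_def by (intro hausdorff_limit_unique) auto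
  qed
  then show ?thesis
    unfolding inner_union_def inner_union_params_def by fastforce
qed

context
  fixes M :: "nat \<Rightarrow> 'a riem" and X :: "'x metric"
    and Z :: "'z metric" and f :: "nat \<Rightarrow> (nat \<Rightarrow> 'a) set \<Rightarrow> 'z" and g :: "'x \<Rightarrow> 'z"
    and r :: "nat \<Rightarrow> nat" and \<delta> :: real and K :: "'y metric"
  assumes M: "\<And>j. open_riemannian_manifold (M j)"
    and Z: "common_embedding M X Z f g"
    and r: "strict_mono r"
    and K: "gh_conv (\<lambda>j. inner_completion (M j) \<delta>) K"
begin

lemma
  shows manifold_embedding: "isometric_embedding (mcompletion (M j)) Z (f j)"
    and limit_embedding: "isometric_embedding X Z g"
  using Z by (auto simp: common_embedding_def)

lemma eventually_gh_close:
  assumes "e > 0"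
  shows "eventually (\<lambda>k. gh_dist (inner_completion (M (r k)) \<delta>) K < ennreal e) sequentially"
proof -
  have "(\<lambda>k. gh_dist (inner_completion (M (r k)) \<delta>) K) \<longlonglongrightarrow> 0"
    using LIMSEQ_subseq_LIMSEQ[OF K[unfolded gh_conv_def] r] by (simp add: o_def)
  then show ?thesis using order_tendstoD(2)[of _ 0 sequentially "ennreal e"] assms by simp
qed

lemma eventually_hausdorff_close:
  assumes "inner_limit M X Z f g r t W" "e > 0"
  shows "eventually (\<lambda>k. hausdorff_dist (mdist Z) (f (r k) ` inner_in_completion (M (r k)) t) W
    < ennreal e) sequentially"
  using assms by (intro hausdorff_conv_eventually) (auto simp: inner_limit_def)

text \<open>
Far out in the subsequence, the limit \<open>K\<close> of the \<open>\<delta>\<close>-inner regions is almost isometric to the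
\<open>\<delta>\<close>-inner region, which lies in the \<open>t\<close>-inner region, which is close to \<open>W\<close>. The parameter \<open>t\<close> is
admissible, so \<open>W\<close> is part of the inner union; for \<open>\<delta>\<close> the regions converge only in the
Gromov-Hausdorff sense, which says nothing about their position in \<open>Z\<close>.
\<close>

lemma limit_embeds_in_inner_union:
  assumes t: "0 < t" "t \<le> \<delta>" and W: "inner_limit M X Z f g r t W" and e: "e > 0"
  shows "almost_embeds (mspace K) (mdist K) (inner_union M X Z f g r) (mdist X) e"
proof -
  \<comment> \<open>two moves, each by less than \<open>e'\<close>, change a distance by at most \<open>4 * e'\<close>\<close>
  define e' where "e' = e / 4"
  have "e' > 0" using e by (simp add: e'_def)
  obtain k where k: "gh_dist (inner_completion (M (r k)) \<delta>) K < ennreal e'"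
    "hausdorff_dist (mdist Z) (f (r k) ` inner_in_completion (M (r k)) t) W < ennreal e'"
    using eventually_happens'[OF sequentially_bot
      eventually_conj[OF eventually_gh_close eventually_hausdorff_close[OF W]]] \<open>e' > 0\<close> by blast
  let ?I = "\<lambda>s. f (r k) ` inner_in_completion (M (r k)) s"
  have WX: "W \<subseteq> g ` mspace X" and WZ: "W \<subseteq> mspace Z"
    using W compactin_subset_topspace by (force simp: inner_limit_def)+
  have "almost_embeds (mspace K) (mdist K) (?I \<delta>) (mdist Z) (2 * e')"
    using almost_embeds_trans[OF gh_dist_less_almost_embeds(2)[OF k(1)]
      inner_completion_to_image[OF M manifold_embedding]] by simp
  moreover have "?I \<delta> \<subseteq> ?I t" by (intro image_mono inner_in_completion_antimono M t)
  ultimately have "almost_embeds (mspace K) (mdist K) (?I t) (mdist Z) (2 * e')"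
    by (rule almost_embeds_mono[OF _ order_refl _ order_refl])
  moreover have "almost_embeds (?I t) (mdist Z) W (mdist Z) (2 * e')"
    by (rule almost_embeds_near[OF inner_image_subset[OF M manifold_embedding] WZ]) (rule hausdorff_dist_less(1)[OF k(2)])
  ultimately have "almost_embeds (mspace K) (mdist K) W (mdist Z) (2 * e' + 2 * e')"
    by (rule almost_embeds_trans)
  moreover have "almost_embeds W (mdist Z) (inner_union M X Z f g r) (mdist X) 0"
  proof (rule almost_embeds_isometric[of _ "inv_into (mspace X) g"])
    have inv: "inv_into (mspace X) g w \<in> mspace X" "g (inv_into (mspace X) g w) = w" if "w \<in> W" for w
      using WX that by (auto intro: inv_into_into f_inv_into_f)
    show "inv_into (mspace X) g w \<in> inner_union M X Z f g r" if "w \<in> W" for w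
      using inv[OF that] t W that by (auto simp: inner_union_eq[OF M Z])
    show "mdist X (inv_into (mspace X) g w) (inv_into (mspace X) g w') = mdist Z w w'"
      if "w \<in> W" "w' \<in> W" for w w'
      using limit_embedding inv[OF that(1)] inv[OF that(2)] unfolding isometric_embedding_def by metis
  qed
  ultimately have "almost_embeds (mspace K) (mdist K) (inner_union M X Z f g r) (mdist X)
      (2 * e' + 2 * e' + 0)"
    by (rule almost_embeds_trans)
  then show ?thesis by (simp add: e'_def)
qed

text \<open>
Finitely many points are handled by one index \<open>k\<close>: each is close to a point of the inner region for its
own parameter \<open>t\<close>, and these regions all lie in the \<open>\<delta>\<close>-inner region, which is almost isometric to \<open>K\<close>.
\<close>

lemma inner_union_embeds_in_limit:
  assumes "finite F" "e > 0"
    and F: "\<And>x. x \<in> F \<Longrightarrow> x \<in> mspace X \<and> (\<exists>t W. \<delta> \<le> t \<and> inner_limit M X Z f g r t W \<and> g x \<in> W)"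
  shows "almost_embeds F (mdist X) (mspace K) (mdist K) e"
proof -
  define e' where "e' = e / 4"
  have "e' > 0" using \<open>e > 0\<close> by (simp add: e'_def)
  have "\<forall>x\<in>F. \<exists>tW. \<delta> \<le> fst tW \<and> inner_limit M X Z f g r (fst tW) (snd tW) \<and> g x \<in> snd tW"
    using F by fastforce
  from bchoice[OF this] obtain tW where
    tW: "\<And>x. x \<in> F \<Longrightarrow> \<delta> \<le> fst (tW x) \<and> inner_limit M X Z f g r (fst (tW x)) (snd (tW x)) \<and> g x \<in> snd (tW x)"
    by blast
  have "eventually (\<lambda>k. \<forall>x\<in>F. hausdorff_dist (mdist Z)
      (f (r k) ` inner_in_completion (M (r k)) (fst (tW x))) (snd (tW x)) < ennreal e') sequentially"
    using tW \<open>e' > 0\<close> eventually_hausdorff_close by (intro eventually_ball_finite assms(1)) blast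
  from eventually_happens'[OF sequentially_bot eventually_conj[OF eventually_gh_close[OF \<open>e' > 0\<close>] this]]
  obtain k where k: "gh_dist (inner_completion (M (r k)) \<delta>) K < ennreal e'"
    "\<And>x. x \<in> F \<Longrightarrow> hausdorff_dist (mdist Z)
      (f (r k) ` inner_in_completion (M (r k)) (fst (tW x))) (snd (tW x)) < ennreal e'"
    by blast
  let ?I = "\<lambda>s. f (r k) ` inner_in_completion (M (r k)) s"
  have gd: "g x \<in> mspace Z" "mdist Z (g x) (g y) = mdist X x y" if "x \<in> F" "y \<in> F" for x y
    using limit_embedding F[OF that(1)] F[OF that(2)] by (auto simp: isometric_embedding_def)
  have "almost_embeds F (mdist X) (g ` F) (mdist Z) 0"
    by (rule almost_embeds_isometric[of _ g]) (auto simp: gd)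
  moreover have "almost_embeds (g ` F) (mdist Z) (?I \<delta>) (mdist Z) (2 * e')"
  proof (rule almost_embeds_near[OF _ inner_image_subset[OF M manifold_embedding]])
    show "g ` F \<subseteq> mspace Z" using gd(1) by blast
    fix z assume "z \<in> g ` F"
    then obtain x where x: "x \<in> F" "z = g x" by blast
    obtain a where a: "a \<in> ?I (fst (tW x))" "mdist Z a z < e'"
      using hausdorff_dist_less(2)[OF k(2)[OF x(1)]] tW[OF x(1)] x(2) by blast
    have "?I (fst (tW x)) \<subseteq> ?I \<delta>"
      using tW[OF x(1)] by (intro image_mono inner_in_completion_antimono M) blast
    then show "\<exists>a\<in>?I \<delta>. mdist Z z a < e'"
      using a by (intro bexI[of _ a]) (auto simp: mdist_commute)
  qed
  ultimately have "almost_embeds F (mdist X) (?I \<delta>) (mdist Z) (0 + 2 * e')"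
    by (rule almost_embeds_trans)
  from almost_embeds_trans[OF this almost_embeds_trans[OF image_to_inner_completion[OF M manifold_embedding]
      gh_dist_less_almost_embeds(1)[OF k(1)]]]
  show ?thesis by (simp add: e'_def)
qed

end

theorem theorem6p6:
  fixes M :: "nat \<Rightarrow> 'a riem"
    and X :: "'x metric"
    and \<delta> :: "nat \<Rightarrow> real" and Y :: "real \<Rightarrow> 'y metric" and \<psi> :: "nat \<Rightarrow> 'y \<Rightarrow> 'y"
    and Z :: "'z metric" and f :: "nat \<Rightarrow> (nat \<Rightarrow> 'a) set \<Rightarrow> 'z" and g :: "'x \<Rightarrow> 'z"
    and r :: "nat \<Rightarrow> nat"
  assumes "\<And>j. open_riemannian_manifold (M j)"
    and "\<And>j. compact_metric (mcompletion (M j))"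
    and "compact_metric X"
    and "gh_conv (\<lambda>j. mcompletion (M j)) X"
    and "glued_limit_data M \<delta> Y \<psi>"
    and "common_embedding M X Z f g"
    and "strict_mono r"
    and "\<exists>s :: nat \<Rightarrow> real. (\<forall>n. s n \<in> inner_union_params M X Z f g r) \<and> s \<longlonglongrightarrow> 0"
  shows "isometric (completed_glued_limit \<delta> Y \<psi>)
           (submetric X (mtopology_of X closure_of inner_union M X Z f g r))"
proof -
  note M = assms(1) and X = assms(3) and glued = assms(5) and Z = assms(6) and r = assms(7)
  define U where "U = inner_union M X Z f g r"
  define B where "B = submetric X (mtopology_of X closure_of U)"
  have UX: "U \<subseteq> mspace X" unfolding U_def inner_union_eq[OF M Z] by blast
  have B: "mspace B = mtopology_of X closure_of U" "mdist B = mdist X"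
    using closure_of_subset_topspace[of "mtopology_of X" U] by (auto simp: B_def)
  have UB: "U \<subseteq> mspace B" unfolding B using UX by (intro closure_of_subset) simp
  have pos: "\<delta> i > 0" and lim: "\<delta> \<longlonglongrightarrow> 0"
    and conv: "gh_conv (\<lambda>j. inner_completion (M j) (\<delta> i)) (Y (\<delta> i))" for i
    using glued by (auto simp: glued_limit_data_def)
  have emb: "isometric_embedding (Y (\<delta> i)) (Y (\<delta> (Suc i))) (\<psi> i)" for i
  proof (cases "\<delta> (Suc i) = \<delta> i")
    case True
    then have "\<forall>x\<in>mspace (Y (\<delta> i)). \<psi> i x = x" using glued unfolding glued_limit_data_def by metis
    then show ?thesis using True by (simp add: isometric_embedding_def)
  next
    case False
    then have "subseq_limit_embedding M (\<delta> (Suc i)) (\<delta> i) (Y (\<delta> (Suc i))) (Y (\<delta> i)) (\<psi> i)"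
      using glued unfolding glued_limit_data_def by metis
    then show ?thesis by (simp add: subseq_limit_embedding_def)
  qed
  have piece_U: "almost_embeds (mspace (Y (\<delta> i))) (mdist (Y (\<delta> i))) U (mdist X) e" if "e > 0" for i e
  proof -
    obtain s :: "nat \<Rightarrow> real" where s: "\<And>n. s n \<in> inner_union_params M X Z f g r" "s \<longlonglongrightarrow> 0"
      using assms(8) by blast
    obtain n where "s n < \<delta> i"
      using eventually_happens'[OF sequentially_bot order_tendstoD(2)[OF s(2) pos[of i]]] by blast
    moreover obtain W where "s n > 0" "inner_limit M X Z f g r (s n) W"
      using s(1)[of n] by (auto simp: inner_union_params_def)
    ultimately show ?thesis
      unfolding U_def using limit_embeds_in_inner_union[OF M Z r conv] that by (meson less_imp_le)
  qed
  have "isometric (completion (glued_points \<delta> Y \<psi>) (glued_dist \<delta> Y \<psi>)) B"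
  proof (rule isometric_completion_if_mutually_approximable)
    show "compact_metric B" unfolding B_def by (rule compact_submetric_closure[OF X])
  next
    fix F and e :: real assume "finite F" "F \<subseteq> glued_points \<delta> Y \<psi>" "e > 0"
    then obtain i where
      "almost_embeds F (glued_dist \<delta> Y \<psi>) (mspace (Y (\<delta> i))) (mdist (Y (\<delta> i))) 0"
      using finite_glued_points_embed[where \<delta> = \<delta> and Y = Y and \<psi> = \<psi>, OF emb] by blast
    from almost_embeds_trans[OF this piece_U[OF \<open>e > 0\<close>]]
    show "almost_embeds F (glued_dist \<delta> Y \<psi>) (mspace B) (mdist B) e"
      unfolding B(2) by (rule almost_embeds_mono[OF _ order_refl UB]) simp
  next
    fix F and e :: real assume F: "finite F" "F \<subseteq> mspace B" and "e > 0"
    \<comment> \<open>moving \<open>F\<close> into the inner union costs \<open>2 * e'\<close>, mapping it to the piece another \<open>e'\<close>\<close>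
    define e' where "e' = e / 3"
    have "e' > 0" using \<open>e > 0\<close> by (simp add: e'_def)
    have "\<forall>x\<in>F. \<exists>u. u \<in> U \<and> mdist X x u < e'"
    proof
      fix x assume "x \<in> F"
      then have "x \<in> mtopology_of X closure_of U" using F(2) B by blast
      then show "\<exists>u. u \<in> U \<and> mdist X x u < e'"
        using \<open>e' > 0\<close> by (auto simp: in_closure_iff_near)
    qed
    from bchoice[OF this] obtain p where p: "\<And>x. x \<in> F \<Longrightarrow> p x \<in> U \<and> mdist X x (p x) < e'"
      by blast
    have "F \<subseteq> mspace X" using F(2) by (auto simp: B_def)
    then have near: "almost_embeds F (mdist B) (p ` F) (mdist X) (2 * e')"
      unfolding B(2) using p UX by (intro almost_embeds_near) auto
    have pU: "\<forall>u\<in>p ` F. \<exists>t W. t > 0 \<and> inner_limit M X Z f g r t W \<and> g u \<in> W"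
      using p unfolding U_def inner_union_eq[OF M Z] by blast
    have ev: "\<forall>u\<in>p ` F. eventually (\<lambda>i. \<exists>t W. \<delta> i \<le> t \<and> inner_limit M X Z f g r t W \<and> g u \<in> W)
        sequentially"
    proof
      fix u assume "u \<in> p ` F"
      with pU obtain t W where t: "t > 0" "inner_limit M X Z f g r t W" "g u \<in> W" by blast
      from order_tendstoD(2)[OF lim t(1)]
      show "eventually (\<lambda>i. \<exists>t W. \<delta> i \<le> t \<and> inner_limit M X Z f g r t W \<and> g u \<in> W) sequentially"
        by eventually_elim (use t in \<open>auto intro: less_imp_le\<close>)
    qed
    obtain i where i: "\<forall>u\<in>p ` F. \<exists>t W. \<delta> i \<le> t \<and> inner_limit M X Z f g r t W \<and> g u \<in> W"
      using eventually_happens'[OF sequentially_bot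
        eventually_ball_finite[OF finite_imageI[OF F(1)] ev]] by blast
    have "almost_embeds (p ` F) (mdist X) (mspace (Y (\<delta> i))) (mdist (Y (\<delta> i))) e'"
      by (rule inner_union_embeds_in_limit[OF M Z r conv finite_imageI[OF F(1)] \<open>e' > 0\<close>])
        (use i p UX in blast)
    from almost_embeds_trans[OF near almost_embeds_trans[OF this piece_embeds_in_glued_points[where \<delta> = \<delta> and Y = Y and \<psi> = \<psi>, OF emb]]]
    show "almost_embeds F (mdist B) (glued_points \<delta> Y \<psi>) (glued_dist \<delta> Y \<psi>) e"
      by (simp add: e'_def)
  qed
  then show ?thesis by (simp add: completed_glued_limit_def B_def U_def)
qed

end
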